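(* Let $0<d<\pi/2$, $\mathscr{D}_d=\{\zeta\in\mathbb{C}:|\Im\zeta|<d\}$, and $\psi(t)=\log(1+e^{\pi\sinh t})$. Assume $f$ is analytic on $\psi(\mathscr{D}_d)$ and there are constants $K>0$, $\beta>0$, $0<\alpha\le1$ with $|f(z)|\le K\left|\left(\frac{z}{1+z}\right)^{\alpha-1}e^{-\beta z}\right|$ for all $z\in\psi(\mathscr{D}_d)$. Let $\mu=\min\{\alpha,\beta\}$, $\nu=\max\{\alpha,\beta\}$, let $n$ be a positive integer, $h=\log(2dn/\mu)/n$, and let $M=n$, $N=n-\lfloor\log(\beta/\alpha)/h\rfloor$ if $\mu=\alpha$, and $N=n$, $M=n-\lfloor\log(\alpha/\beta)/h\rfloor$ if $\mu=\beta$. Suppose $n\ge\nu e/(2d)$, $Mh\ge x_\alpha$, $Nh\ge x_\beta$. Then \[ \sup_{\tau\in(0,\infty)}\left|\int_0^{\tau}f(t)\,dt-\sum_{k=-M}^{N}f(\psi(kh))\psi'(kh)J(k,h)(\psi^{-1}(\tau))\right|\le C\,\frac{e^{-\pi dn/\log(2dn/\mu)}\log(2dn/\mu)}{n}, \] with \[ C=\frac{2K}{\mu d}\left\{\frac{(\tilde c_d)^{1-\alpha}}{(1-e^{-\pi\mu e})\{\cos(\frac\pi2\sin d)\}^{\alpha+\beta}\cos d}+e^{\pi(1+5\alpha+6\beta)/12}\right\}, \] where $c_d=1+1/\cos(\frac\pi2\sin d)$ and $\tilde c_d=\frac{1+\log(1+c_d)}{\log(1+c_d)}c_d$.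
   Context: $J(k,h)(x)=h\left\{\frac12+\frac1\pi\operatorname{Si}[\pi(x/h-k)]\right\}$ with $\operatorname{Si}(x)=\int_0^x\frac{\sin\sigma}{\sigma}d\sigma$. For $\gamma>0$, $x_\gamma=\operatorname{arcsinh}\!\left(\frac{\sqrt{1+\sqrt{1-(2\pi\gamma)^2}}}{2\pi\gamma}\right)$ if $0<\gamma<1/(2\pi)$, and $x_\gamma=\operatorname{arcsinh}(1)$ if $\gamma\ge1/(2\pi)$. Complex logarithms and powers use principal branches.
   Formalization: On the strip, ψ is taken as the analytic continuation of the real function log(1+e^{π sinh t}), not the principal logarithm (which is discontinuous there and makes the claim false); the bound on f is not required at z=−1. *)

theory Defs
  imports "HOL-Analysis.Analysis" "HOL-Probability.Sinc_Integral"
begin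

text \<open>Si is the library's sine integral: Si t = LBINT x=0..t. sin x / x.\<close>

definition Jfun :: "int \<Rightarrow> real \<Rightarrow> real \<Rightarrow> real" where
  "Jfun k h x = h * (1/2 + Si (pi * (x / h - real_of_int k)) / pi)"

definition psi :: "real \<Rightarrow> real" where
  "psi t = ln (1 + exp (pi * sinh t))"

text \<open>Inverse of psi : R -> (0,inf), valid for tau > 0.\<close>
definition psi_inv :: "real \<Rightarrow> real" where
  "psi_inv tau = arsinh (ln (exp tau - 1) / pi)"

definition x_gamma :: "real \<Rightarrow> real" where
  "x_gamma g = (if g < 1 / (2*pi)
     then arsinh (sqrt (1 + sqrt (1 - (2*pi*g)^2)) / (2*pi*g))
     else arsinh 1)"

definition strip :: "real \<Rightarrow> complex set" where
  "strip d = {z. \<bar>Im z\<bar> < d}"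

end

theory Submission
  imports Defs "HOL-Complex_Analysis.Complex_Analysis"
begin

text \<open>
  Put \<open>F z = f (psi_c z) * psi_c' z\<close>, so that the integral of \<open>f\<close> over \<open>(0, tau)\<close> is that of
  \<open>F\<close> over \<open>(-\<infinity>, x)\<close> with \<open>x = psi_inv tau\<close>.

  Discretization error: the residue theorem on large rectangles writes the error of sinc
  interpolation of \<open>F\<close> at \<open>t\<close> as \<open>sin (pi t / h) / (2 pi i)\<close> times a contour integral of
  \<open>F z / ((z - t) sin (pi z / h))\<close>. Integrating over \<open>t\<close> first, one integration by parts bounds
  the integral of \<open>sin (pi t / h) / (z - t)\<close> by a multiple of \<open>h / \<bar>Im z\<bar>\<close>, while
  \<open>1 / \<bar>sin (pi z / h)\<bar> \<le> 1 / sinh (pi \<bar>Im z\<bar> / h)\<close> supplies the exponential decay. The vertical sides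
  vanish in the limit and \<open>\<bar>Im z\<bar>\<close> tends to \<open>d\<close>. The integral of \<open>\<bar>F\<bar>\<close> along horizontal lines is
  controlled by
  \<open>(1 + exp (pi sinh x cos y)) cos (pi/2 sin y) \<le> \<bar>1 + exp (pi sinh (x + i y))\<bar>\<close>.

  Truncation error: on the real line \<open>F\<close> decays doubly exponentially, and the omitted terms are
  dominated by a telescoping sum.
\<close>

subsection \<open>Elementary inequalities\<close>

text \<open>The constants leave little room, and this fixes several choices. The left end point
  \<open>a\<close> of the integration in \<open>t\<close> runs through zeros of cos (pi t / h), so
  that the integration by parts has a single boundary term. This gives the factor 1 + 1/pi, and (1 +
  1/pi) / pi is below 1/2 as the first summand of the constant demands; a second boundary term would
  give (1 + 2/pi) / pi, which exceeds 1/2. \<open>F\<close> is only given on the open strip. The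
  contour therefore runs at height \<open>e < d\<close>, all bounds for \<open>F\<close> are made
  independent of the height, and \<open>e\<close> tends to \<open>d\<close> in the last step only.
  The truncated terms decay like exp (- pi d n), while the stated rate is exp (- pi d n / L) with L
  = log (2 d n / mu). The gain pays for |J| <= 3/2 h, for the factor 1 + h lost in the telescoping,
  and for dividing by h. Near L = 1 there is no gain, and the second summand exp (pi (1 + 5 alpha +
  6 beta) / 12) of the constant has to cover these losses instead.\<close>

lemma cosh_ge_quadratic: "1 + b\<^sup>2 / 2 \<le> cosh (b::real)"
proof -
  have "\<bar>b/2\<bar> \<le> \<bar>sinh (b/2)\<bar>"
    using real_le_abs_sinh[of "b/2"] by (simp add: sinh_field_def exp_minus)
  then have "(b/2)\<^sup>2 \<le> (sinh (b/2))\<^sup>2"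
    by (simp only: abs_le_square_iff)
  moreover have "cosh b = 1 + 2 * (sinh (b/2))\<^sup>2"
    using cosh_double[of "b/2"] by (simp add: cosh_square_eq)
  ultimately show ?thesis by (simp add: power_divide)
qed

lemma cos_ge_quadratic: "1 - x\<^sup>2 / 2 \<le> cos (x::real)"
proof -
  have "(sin (x/2))\<^sup>2 \<le> (x/2)\<^sup>2"
    using abs_sin_x_le_abs_x[of "x/2"] by (simp only: abs_le_square_iff)
  moreover have "cos x = 1 - 2 * (sin (x/2))\<^sup>2"
    using cos_double_sin[of "x/2"] by simp
  ultimately show ?thesis by (simp add: power_divide)
qed

section \<open>A sharp lower bound for the modulus of \<open>1 + exp (pi * sinh z)\<close>\<close>

lemma mult_cos_le_sin:
  fixes x :: real
  assumes "0 \<le> x" "x \<le> pi"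
  shows "x * cos x \<le> sin x"
proof -
  have "(\<lambda>t. sin t - t * cos t) 0 \<le> (\<lambda>t. sin t - t * cos t) x"
  proof (rule DERIV_nonneg_imp_nondecreasing[OF assms(1)])
    fix t assume "0 \<le> t" "t \<le> x"
    then have "0 \<le> t * sin t" using assms by (simp add: sin_ge_zero)
    then show "\<exists>y. ((\<lambda>t. sin t - t * cos t) has_real_derivative y) (at t) \<and> 0 \<le> y"
      by (intro exI[of _ "t * sin t"]) (auto intro!: derivative_eq_intros)
  qed
  then show ?thesis by simp
qed

text \<open>First-order case of \<open>abs_sin_mult_le_sin_cosh\<close>: at \<open>C = 1\<close>
  both sides of that inequality equal sin theta, and the two sides here are their derivatives in
  \<open>C\<close>. Both vanish at 0 and at pi/2, so each end gets its own estimate.\<close>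

lemma mult_cos_le_quadratic_sin:
  fixes \<theta> :: real
  assumes "0 \<le> \<theta>" "\<theta> \<le> pi/2"
  shows "\<theta> * cos \<theta> \<le> (pi\<^sup>2/4 - \<theta>\<^sup>2) * sin \<theta>"
proof (cases "\<theta> \<le> pi/6")
  case True
  have "\<theta>\<^sup>2 \<le> (pi/6)\<^sup>2" using True assms by (intro power_mono) auto
  moreover have "pi\<^sup>2 \<ge> 3\<^sup>2" using pi_gt3 by (intro power_mono) auto
  ultimately have "1 \<le> pi\<^sup>2/4 - \<theta>\<^sup>2" by (simp add: power_divide)
  moreover have "0 \<le> sin \<theta>" using assms by (simp add: sin_ge_zero)
  ultimately have "1 * sin \<theta> \<le> (pi\<^sup>2/4 - \<theta>\<^sup>2) * sin \<theta>" by (rule mult_right_mono)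
  with mult_cos_le_sin[of \<theta>] assms show ?thesis by simp
next
  case False
  define \<delta> where "\<delta> = pi/2 - \<theta>"
  have d: "0 \<le> \<delta>" "\<delta> \<le> pi/3" using False assms by (auto simp: \<delta>_def)
  have "cos (pi/3) \<le> cos \<delta>" using d by (intro cos_monotone_0_pi_le) auto
  then have c: "1/2 \<le> cos \<delta>" by (simp add: cos_60)
  have "\<theta> * cos \<theta> = (pi/2 - \<delta>) * sin \<delta>" by (simp add: \<delta>_def sin_cos_eq)
  also have "\<dots> \<le> (pi/2 - \<delta>) * \<delta>"
    using d by (intro mult_left_mono sin_x_le_x) auto
  also have "\<dots> \<le> (\<delta> * (pi - \<delta>)) * (1/2)"
    using d by (auto simp: field_simps)
  also have "\<dots> \<le> (\<delta> * (pi - \<delta>)) * cos \<delta>"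
    using c d by (intro mult_left_mono) auto
  also have "\<dots> = (pi\<^sup>2/4 - \<theta>\<^sup>2) * sin \<theta>"
  proof -
    have "cos \<delta> = sin \<theta>" by (simp add: \<delta>_def sin_cos_eq)
    moreover have "\<delta> * (pi - \<delta>) = pi\<^sup>2/4 - \<theta>\<^sup>2" by (simp add: \<delta>_def power2_eq_square algebra_simps)
    ultimately show ?thesis by simp
  qed
  finally show ?thesis .
qed

text \<open>Applied with theta = pi/2 * sin y, C = cosh x and b = pi/2 * sinh x * cos y. While theta
  * C <= pi/2, an expansion about C = 1 suffices; beyond that, C is so far from 1 that the right
  side is at least 1.\<close>

lemma abs_sin_mult_le_sin_cosh:
  fixes \<theta> C b :: real
  assumes th: "0 \<le> \<theta>" "\<theta> < pi/2" and C: "1 \<le> C"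
    and b: "b\<^sup>2 = (pi\<^sup>2/4 - \<theta>\<^sup>2) * (C\<^sup>2 - 1)"
  shows "\<bar>sin (\<theta> * C)\<bar> \<le> sin \<theta> * cosh b"
proof (cases "\<theta> * C \<le> pi/2")
  case True
  have s0: "0 \<le> sin \<theta>" "0 \<le> cos \<theta>" using th by (auto simp: sin_ge_zero intro!: cos_ge_zero)
  define e where "e = \<theta> * (C - 1)"
  have e0: "0 \<le> e" using th C by (simp add: e_def)
  have q: "0 \<le> pi\<^sup>2/4 - \<theta>\<^sup>2"
  proof -
    have "\<theta>\<^sup>2 \<le> (pi/2)\<^sup>2" using th by (intro power_mono) auto
    then show ?thesis by (simp add: power_divide)
  qed
  have "\<bar>sin (\<theta> * C)\<bar> = sin (\<theta> + e)"
    using True th C by (simp add: e_def algebra_simps sin_ge_zero)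
  also have "\<dots> = sin \<theta> * cos e + cos \<theta> * sin e" by (rule sin_add)
  also have "\<dots> \<le> sin \<theta> * 1 + cos \<theta> * e"
    using s0 e0 by (intro add_mono mult_left_mono sin_x_le_x) auto
  also have "\<dots> = sin \<theta> + (\<theta> * cos \<theta>) * (C - 1)" by (simp add: e_def)
  also have "\<dots> \<le> sin \<theta> + ((pi\<^sup>2/4 - \<theta>\<^sup>2) * sin \<theta>) * (C - 1)"
    using mult_cos_le_quadratic_sin[of \<theta>] th C by (intro add_left_mono mult_right_mono) auto
  also have "\<dots> = sin \<theta> * (1 + (pi\<^sup>2/4 - \<theta>\<^sup>2) * (C - 1))" by (simp add: algebra_simps)
  also have "\<dots> \<le> sin \<theta> * (1 + (pi\<^sup>2/4 - \<theta>\<^sup>2) * ((C\<^sup>2 - 1)/2))"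
  proof -
    have "0 \<le> (C - 1)\<^sup>2" by simp
    then have "C - 1 \<le> (C\<^sup>2 - 1)/2" by (simp add: power2_eq_square algebra_simps)
    then show ?thesis using q s0 by (intro mult_left_mono add_left_mono) auto
  qed
  also have "\<dots> = sin \<theta> * (1 + b\<^sup>2/2)" by (simp add: b)
  also have "\<dots> \<le> sin \<theta> * cosh b"
    using cosh_ge_quadratic s0 by (intro mult_left_mono) auto
  finally show ?thesis .
next
  case False
  have tpos: "0 < \<theta>" using False th by (cases "\<theta> = 0") auto
  define Q where "Q = pi\<^sup>2/4 - \<theta>\<^sup>2"
  define \<delta> where "\<delta> = pi/2 - \<theta>"
  have d0: "0 < \<delta>" using th by (simp add: \<delta>_def)
  have Q: "Q = \<delta> * (pi/2 + \<theta>)" by (simp add: Q_def \<delta>_def power2_eq_square algebra_simps)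
  then have Q0: "0 \<le> Q" using d0 th by simp
  \<comment> \<open>From theta * C > pi/2 follows C^2 - 1 >= Q / theta^2, hence |b| >= Q /
    theta.\<close>
  have "(pi/2)\<^sup>2 \<le> (\<theta> * C)\<^sup>2" using False by (intro power_mono) auto
  then have "Q \<le> \<theta>\<^sup>2 * (C\<^sup>2 - 1)" by (simp add: Q_def power_divide power_mult_distrib algebra_simps)
  then have "Q / \<theta>\<^sup>2 \<le> C\<^sup>2 - 1" using tpos by (simp add: field_simps)
  then have "Q * (Q / \<theta>\<^sup>2) \<le> b\<^sup>2"
    unfolding b Q_def[symmetric] using Q0 by (rule mult_left_mono)
  then have b2: "(Q / \<theta>)\<^sup>2 \<le> b\<^sup>2" by (simp add: power2_eq_square)
  have s0: "0 \<le> sin \<theta>" using th by (simp add: sin_ge_zero)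
  \<comment> \<open>Near pi/2, sin theta = cos delta loses at most delta^2 / 2, which the gain 2
    delta^2 from b^2 / 2 outweighs. Away from pi/2, b^2 >= 2 pi / theta makes up for having only sin
    theta >= theta / 2.\<close>
  have "1 \<le> sin \<theta> * (1 + b\<^sup>2/2)"
  proof (cases "\<delta> \<le> 1")
    case True
    have "2 \<le> (pi/2 + \<theta>) / \<theta>" using tpos th by (simp add: field_simps)
    then have "\<delta> * 2 \<le> Q / \<theta>"
      unfolding Q using mult_left_mono[of 2 "(pi/2 + \<theta>) / \<theta>" \<delta>] d0 by simp
    then have "(\<delta> * 2)\<^sup>2 \<le> (Q / \<theta>)\<^sup>2" using d0 by (intro power_mono) auto
    with b2 have b3: "4 * \<delta>\<^sup>2 \<le> b\<^sup>2" by (simp add: power_mult_distrib)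
    have d2: "\<delta>\<^sup>2 \<le> 1" using True d0 by (simp add: power_le_one)
    have "0 \<le> \<delta>\<^sup>2 * (3/2 - \<delta>\<^sup>2)" using d2 by simp
    then have "1 \<le> (1 - \<delta>\<^sup>2/2) * (1 + 2 * \<delta>\<^sup>2)" by (simp add: algebra_simps)
    also have "\<dots> \<le> sin \<theta> * (1 + b\<^sup>2/2)"
    proof (rule mult_mono)
      show "1 - \<delta>\<^sup>2/2 \<le> sin \<theta>" using cos_ge_quadratic[of \<delta>] by (simp add: \<delta>_def sin_cos_eq)
    qed (use b3 s0 in auto)
    finally show ?thesis .
  next
    case False
    then have th3: "\<theta> \<le> pi/3" using pi_approx by (simp add: \<delta>_def)
    have "cos (pi/3) \<le> cos \<theta>" using th th3 by (intro cos_monotone_0_pi_le) auto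
    then have "\<theta> * (1/2) \<le> \<theta> * cos \<theta>" using th by (intro mult_left_mono) (auto simp: cos_60)
    also have "\<dots> \<le> sin \<theta>" using th by (intro mult_cos_le_sin) auto
    finally have s1: "\<theta> / 2 \<le> sin \<theta>" by simp
    have "1 * (pi/2 + \<theta>) \<le> Q" unfolding Q using False th by (intro mult_right_mono) auto
    then have "(pi/2 + \<theta>)\<^sup>2 \<le> Q\<^sup>2" using th by (intro power_mono) auto
    moreover have "2 * pi * \<theta> \<le> (pi/2 + \<theta>)\<^sup>2"
      using zero_le_power2[of "pi/2 - \<theta>"] by (simp add: power2_eq_square algebra_simps)
    ultimately have "2 * pi * \<theta> / \<theta>\<^sup>2 \<le> Q\<^sup>2 / \<theta>\<^sup>2" by (intro divide_right_mono) auto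
    with b2 have b3: "2 * pi / \<theta> \<le> b\<^sup>2" using tpos by (simp add: power_divide power2_eq_square)
    have "1 \<le> pi / 2" using pi_gt3 by simp
    also have "pi / 2 = (\<theta> / 2) * (pi / \<theta>)" using tpos by simp
    also have "\<dots> \<le> sin \<theta> * (1 + b\<^sup>2/2)"
      using s1 b3 tpos s0 by (intro mult_mono) auto
    finally show ?thesis .
  qed
  also have "\<dots> \<le> sin \<theta> * cosh b" using cosh_ge_quadratic s0 by (intro mult_left_mono) auto
  finally show ?thesis using abs_sin_le_one[of "\<theta> * C"] by linarith
qed

lemma cmod_one_plus_exp_sq:
  "(cmod (1 + exp z))\<^sup>2 = (1 + exp (Re z))\<^sup>2 - 4 * exp (Re z) * (sin (Im z / 2))\<^sup>2"
proof -
  have c: "cos (Im z) = 1 - 2 * (sin (Im z / 2))\<^sup>2"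
    using cos_double_sin[of "Im z / 2"] by simp
  have "(cmod (1 + exp z))\<^sup>2 = (1 + exp (Re z) * cos (Im z))\<^sup>2 + (exp (Re z) * sin (Im z))\<^sup>2"
    by (simp add: cmod_power2 Re_exp Im_exp)
  also have "\<dots> = 1 + 2 * exp (Re z) * cos (Im z) + (exp (Re z))\<^sup>2 * ((sin (Im z))\<^sup>2 + (cos (Im z))\<^sup>2)"
    by (simp add: power2_eq_square algebra_simps del: sin_cos_squared_add sin_cos_squared_add2 sin_cos_squared_add3)
  also have "\<dots> = (1 + exp (Re z))\<^sup>2 - 4 * exp (Re z) * (sin (Im z / 2))\<^sup>2"
    unfolding sin_cos_squared_add unfolding c by (simp add: power2_eq_square algebra_simps)
  finally show ?thesis .
qed

lemma Re_sinh: "Re (sinh z) = sinh (Re z) * cos (Im z)"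
  and Im_sinh: "Im (sinh z) = cosh (Re z) * sin (Im z)"
  and Re_cosh: "Re (cosh z) = cosh (Re z) * cos (Im z)"
  and Im_cosh: "Im (cosh z) = sinh (Re z) * sin (Im z)"
  by (auto simp: sinh_field_def cosh_field_def Re_exp Im_exp Re_divide_numeral Im_divide_numeral
      algebra_simps diff_divide_distrib add_divide_distrib)

lemma cmod_cosh_le: "cmod (cosh z) \<le> cosh (Re z)"
proof -
  have "(cmod (cosh z))\<^sup>2 = (cosh (Re z))\<^sup>2 * (cos (Im z))\<^sup>2 + (sinh (Re z))\<^sup>2 * (sin (Im z))\<^sup>2"
    by (simp add: cmod_power2 Re_cosh Im_cosh power_mult_distrib)
  also have "\<dots> \<le> (cosh (Re z))\<^sup>2 * (cos (Im z))\<^sup>2 + (cosh (Re z))\<^sup>2 * (sin (Im z))\<^sup>2"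
    by (intro add_left_mono mult_right_mono) (auto simp: cosh_square_eq)
  also have "\<dots> = (cosh (Re z))\<^sup>2" by (simp flip: distrib_left)
  finally show ?thesis by (rule power2_le_imp_le) simp
qed

text \<open>For u, v the real and imaginary part of pi sinh z, the squared modulus is (1 + exp u)^2
  - 4 exp u sin^2 (v/2). Since 4 exp u cosh^2 (u/2) = (1 + exp u)^2, bounding |sin (v/2)| by sin
  theta cosh (u/2) leaves the factor 1 - sin^2 theta. Equality holds at Re z = 0.\<close>

lemma cmod_one_plus_exp_sinh_ge:
  assumes "\<bar>Im z\<bar> < pi/2"
  shows "(1 + exp (pi * (sinh (Re z) * cos (Im z)))) * cos (pi/2 * sin (Im z))
           \<le> cmod (1 + exp (of_real pi * sinh z))"
proof -
  define x where "x = Re z"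
  define y where "y = \<bar>Im z\<bar>"
  define u where "u = pi * (sinh x * cos y)"
  define v where "v = pi * (cosh x * sin y)"
  define \<theta> where "\<theta> = pi/2 * sin y"
  have y: "0 \<le> y" "y < pi/2" using assms by (auto simp: y_def)
  have cy: "cos (Im z) = cos y" by (simp add: y_def)
  have sy: "\<bar>sin (Im z)\<bar> = sin y" 
    using y sin_ge_zero[of y] by (cases "Im z \<ge> 0") (auto simp: y_def)
  have ss: "(sin (Im (of_real pi * sinh z) / 2))\<^sup>2 = (sin (v/2))\<^sup>2"
    by (cases "Im z \<ge> 0") (auto simp: v_def Im_sinh x_def y_def)
  have sin1: "sin y < 1" using sin_monotone_2pi[of y "pi/2"] y by simp
  have th: "0 \<le> \<theta>" "\<theta> < pi/2" using y sin1 by (auto simp: \<theta>_def sin_ge_zero)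
  have "\<bar>sin (\<theta> * cosh x)\<bar> \<le> sin \<theta> * cosh (u/2)"
  proof (rule abs_sin_mult_le_sin_cosh[OF th cosh_real_ge_1])
    have "pi\<^sup>2/4 - \<theta>\<^sup>2 = pi\<^sup>2/4 * (cos y)\<^sup>2"
      unfolding cos_squared_eq by (simp add: \<theta>_def power_mult_distrib power_divide algebra_simps)
    then show "(u/2)\<^sup>2 = (pi\<^sup>2/4 - \<theta>\<^sup>2) * ((cosh x)\<^sup>2 - 1)"
      by (simp add: u_def cosh_square_eq power_mult_distrib power_divide)
  qed
  then have "(sin (v/2))\<^sup>2 \<le> (sin \<theta> * cosh (u/2))\<^sup>2"
    using abs_le_square_iff[of "sin (v/2)" "sin \<theta> * cosh (u/2)"] 
    by (simp add: v_def \<theta>_def mult_ac)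
  then have "4 * exp u * (sin (v/2))\<^sup>2 \<le> 4 * exp u * (sin \<theta> * cosh (u/2))\<^sup>2"
    by (intro mult_left_mono) auto
  also have "4 * exp u * (sin \<theta> * cosh (u/2))\<^sup>2 = (1 + exp u)\<^sup>2 * (sin \<theta>)\<^sup>2"
  proof -
    have "exp u = exp (u/2) * exp (u/2)" by (simp flip: exp_add)
    moreover have "cosh (u/2) = (exp (u/2) + inverse (exp (u/2)))/2" by (simp add: cosh_field_def exp_minus)
    ultimately have "2 * exp (u/2) * cosh (u/2) = 1 + exp u" by (simp add: field_simps)
    then have "(2 * exp (u/2) * cosh (u/2))\<^sup>2 = (1 + exp u)\<^sup>2" by simp
    moreover have "(exp (u/2))\<^sup>2 = exp u" by (simp flip: exp_of_nat_mult)
    ultimately have "4 * exp u * (cosh (u/2))\<^sup>2 = (1 + exp u)\<^sup>2"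
      by (simp add: power_mult_distrib)
    then show ?thesis by (metis mult.assoc mult.commute power_mult_distrib)
  qed
  finally have "4 * exp u * (sin (v/2))\<^sup>2 \<le> (1 + exp u)\<^sup>2 * (sin \<theta>)\<^sup>2" .
  moreover have "Re (of_real pi * sinh z) = u" by (simp add: Re_sinh u_def x_def cy)
  ultimately have "(1 + exp u)\<^sup>2 - (1 + exp u)\<^sup>2 * (sin \<theta>)\<^sup>2 \<le> (cmod (1 + exp (of_real pi * sinh z)))\<^sup>2"
    unfolding cmod_one_plus_exp_sq ss by simp
  also have "(1 + exp u)\<^sup>2 - (1 + exp u)\<^sup>2 * (sin \<theta>)\<^sup>2 = ((1 + exp u) * cos \<theta>)\<^sup>2"
    unfolding power_mult_distrib cos_squared_eq by (simp only: right_diff_distrib mult_1_right)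
  finally have "(1 + exp u) * cos \<theta> \<le> cmod (1 + exp (of_real pi * sinh z))"
    by (rule power2_le_imp_le) simp
  moreover have "cos (pi/2 * sin (Im z)) = cos \<theta>"
    by (cases "Im z \<ge> 0") (auto simp: \<theta>_def y_def)
  ultimately show ?thesis by (simp add: u_def x_def cy)
qed

section \<open>Comparing w / (1 + w) with exp p / (1 + exp p) for w = log (1 + exp p)\<close>

lemma norm_exp_minus_one_le: "norm (exp z - 1) \<le> exp (norm z) - 1"
  for z :: "'a::{real_normed_algebra_1, banach}"
proof -
  have s: "summable (\<lambda>n. norm (inverse (fact (Suc n)) *\<^sub>R z ^ Suc n))"
    using summable_norm_exp[of z] by (subst summable_Suc_iff) simp
  have "norm (exp z - 1) = norm (\<Sum>n. inverse (fact (Suc n)) *\<^sub>R z ^ Suc n)"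
    by (subst exp_first_term) simp
  also have "\<dots> \<le> (\<Sum>n. norm (inverse (fact (Suc n)) *\<^sub>R z ^ Suc n))"
    by (rule summable_norm[OF s])
  also have "\<dots> \<le> (\<Sum>n. inverse (fact (Suc n)) *\<^sub>R norm z ^ Suc n)"
  proof (rule suminf_le[OF _ s])
    show "summable (\<lambda>n. inverse (fact (Suc n)) *\<^sub>R norm z ^ Suc n)"
      using summable_exp[of "norm z"] by (subst summable_Suc_iff) simp
    show "norm (inverse (fact (Suc n)) *\<^sub>R z ^ Suc n) \<le> inverse (fact (Suc n)) *\<^sub>R norm z ^ Suc n" for n
      unfolding norm_scaleR real_scaleR_def by (intro mult_mono norm_power_ineq) auto
  qed
  also have "\<dots> = exp (norm z) - 1" using exp_first_term[of "norm z"] by simp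
  finally show ?thesis .
qed

lemma exp_quotient_mono:
  fixes s t :: real
  assumes "0 < s" "s \<le> t"
  shows "(1 + s) * (exp s - 1) / s \<le> (1 + t) * (exp t - 1) / t"
proof -
  have "(exp s - 1) / s \<le> (exp t - 1) / t"
  proof (cases "s = t")
    case False
    have "exp s \<le> (1 - s/t) * exp 0 + (s/t) * exp t"
      using convex_onD[OF exp_convex, of "s/t" 0 t] assms by simp
    then have "exp s - 1 \<le> (s/t) * (exp t - 1)" by (simp add: algebra_simps)
    then show ?thesis using assms by (simp add: pos_divide_le_eq mult_ac)
  qed simp
  then have "(1 + s) * ((exp s - 1) / s) \<le> (1 + t) * ((exp t - 1) / t)"
    using assms by (intro mult_mono) auto
  then show ?thesis by simp
qed

text \<open>Source of the constant \<open>ct\<close>. For large |w| the factor (1 + w) / w is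
  bounded; for small |w| its pole is cancelled by the zero of exp p / (1 + exp p) = 1 - exp (- w).
  The threshold ln (1 + c) is where exp s - 1 reaches c, so both cases end in the same
  constant.\<close>

lemma cmod_log_ratio_le:
  fixes w p :: complex
  assumes w: "exp w = 1 + exp p" and c: "1 < c" and le: "cmod (exp p / (1 + exp p)) \<le> c"
  shows "cmod ((1 + w) / w * (exp p / (1 + exp p))) \<le> (1 + ln (1 + c)) / ln (1 + c) * c"
proof -
  have w0: "w \<noteq> 0" using w by (metis add_cancel_right_right exp_not_eq_zero exp_zero)
  have lpos: "0 < ln (1 + c)" using c by simp
  show ?thesis
  proof (cases "ln (1 + c) \<le> cmod w")
    case True
    have "cmod ((1 + w) / w) = cmod (1 + 1 / w)" using w0 by (simp add: add_divide_distrib add.commute)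
    also have "\<dots> \<le> 1 + 1 / cmod w" by (rule order_trans[OF norm_triangle_ineq]) (simp add: norm_divide)
    also have "\<dots> \<le> 1 + 1 / ln (1 + c)" using True lpos by (simp add: frac_le)
    finally have "cmod ((1 + w) / w) \<le> (1 + ln (1 + c)) / ln (1 + c)"
      using lpos by (simp add: add_divide_distrib)
    then show ?thesis unfolding norm_mult using le lpos by (intro mult_mono) auto
  next
    case False
    have "exp p / (1 + exp p) = 1 - exp (- w)"
    proof -
      have "exp p / (1 + exp p) = (exp w - 1) / exp w" by (simp add: w)
      also have "\<dots> = 1 - exp (- w)" by (simp add: diff_divide_distrib exp_minus inverse_eq_divide)
      finally show ?thesis .
    qed
    then have "cmod (exp p / (1 + exp p)) = cmod (exp (- w) - 1)" by (simp add: norm_minus_commute)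
    also have "\<dots> \<le> exp (cmod w) - 1"
      using norm_exp_minus_one_le[of "- w"] by simp
    finally have "cmod ((1 + w) / w * (exp p / (1 + exp p))) \<le> ((1 + cmod w) / cmod w) * (exp (cmod w) - 1)"
      unfolding norm_mult norm_divide[of "1 + w"]
      by (intro mult_mono divide_right_mono) (auto intro: order_trans[OF norm_triangle_ineq])
    also have "\<dots> = (1 + cmod w) * (exp (cmod w) - 1) / cmod w" by simp
    also have "\<dots> \<le> (1 + ln (1 + c)) * (exp (ln (1 + c)) - 1) / ln (1 + c)"
      using w0 False by (intro exp_quotient_mono) auto
    finally show ?thesis using c by simp
  qed
qed

text \<open>Real counterpart of \<open>cmod_log_ratio_le\<close>, with w = t. The terms of the
  truncated sum only see the real axis, so their constant contains (3/2) powr (1 - alpha) in place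
  of a power of \<open>ct\<close>.\<close>

lemma real_log_ratio_le:
  fixes t :: real
  assumes "0 < t"
  shows "(1 + t) / t * (1 - exp (- t)) \<le> 3/2"
proof (cases "t < 2")
  case True
  \<comment> \<open>The claim amounts to 1 - t/2 <= (1 + t) exp (- t). Of the two halves of exp t,
    one is absorbed by 1 - t/2 <= exp (- t/2) and the other is expanded to second order.\<close>
  have "(1 - t/2) * exp t = (1 - t/2) * exp (t/2) * exp (t/2)" by (simp flip: exp_add)
  also have "\<dots> \<le> 1 * exp (t/2)"
  proof (rule mult_right_mono)
    have "1 - t/2 \<le> exp (- (t/2))" using exp_ge_add_one_self[of "- (t/2)"] by simp
    then show "(1 - t/2) * exp (t/2) \<le> 1"
      by (simp add: exp_minus field_simps)
  qed simp
  also have "\<dots> \<le> 1 + t/2 + (t/2)\<^sup>2" using exp_bound[of "t/2"] True assms by simp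
  also have "\<dots> \<le> 1 + t"
    using True assms by (simp add: power2_eq_square field_simps)
  finally have "(1 - t/2) \<le> (1 + t) * exp (- t)" by (simp add: exp_minus field_simps)
  then have "(1 + t) * (1 - exp (- t)) \<le> 3/2 * t" by (simp add: algebra_simps)
  then show ?thesis using assms by (simp add: field_simps)
next
  case False
  have "(1 + t) / t * (1 - exp (- t)) \<le> (1 + t) / t * 1" using assms by (intro mult_left_mono) auto
  also have "\<dots> \<le> 3/2" using False by (simp add: field_simps)
  finally show ?thesis .
qed

text \<open>No monotonicity of the summand is needed: the mean value of \<open>cosh\<close> over a step of
  length \<open>h\<close> dominates its right end point value up to the factor \<open>h / (1 - exp (- h)) \<le> 1 + h\<close>,
  so the sum telescopes.\<close>
lemma sum_cosh_exp_sinh_le: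
  fixes h g :: real and a b :: int
  assumes h: "0 < h" and g: "0 < g" and ab: "a \<le> b"
  shows "(\<Sum>k\<in>{a<..b}. h * (pi * cosh (k * h) * exp (- (pi * g * sinh (k * h)))))
           \<le> (1 + h) / g * (exp (- (pi * g * sinh (a * h))) - exp (- (pi * g * sinh (b * h))))"
  using ab
proof (induction rule: int_ge_induct)
  case base
  then show ?case by simp
next
  case (step k)
  define x where "x = real_of_int (k + 1) * h"
  define E where "E = (\<lambda>x. exp (- (pi * g * sinh x)))"
  have xh: "real_of_int k * h = x - h" by (simp add: x_def algebra_simps)
  have "h * (pi * cosh x * E x) \<le> (1 + h) / g * (E (x - h) - E x)"
  proof -
    define c where "c = cosh (x - h/2)"
    have c0: "0 < c" by (simp add: c_def)
    have "cosh x = cosh (x - h/2) * cosh (h/2) + sinh (x - h/2) * sinh (h/2)"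
      using cosh_add[of "x - h/2" "h/2"] by simp
    also have "\<dots> \<le> c * cosh (h/2) + c * sinh (h/2)"
      unfolding c_def using h by (intro add_left_mono mult_right_mono) (auto simp: sinh_le_cosh_real)
    also have "\<dots> = c * exp (h/2)" by (simp add: cosh_plus_sinh flip: distrib_left)
    finally have cx: "cosh x \<le> c * exp (h/2)" .
    have sd: "sinh x - sinh (x - h) = 2 * c * sinh (h/2)"
    proof -
      have "sinh x = sinh (x - h/2) * cosh (h/2) + cosh (x - h/2) * sinh (h/2)"
        using sinh_add[of "x - h/2" "h/2"] by simp
      moreover have "sinh (x - h) = sinh (x - h/2) * cosh (h/2) - cosh (x - h/2) * sinh (h/2)"
        using sinh_diff[of "x - h/2" "h/2"] by simp
      ultimately show ?thesis by (simp add: c_def)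
    qed
    have eh: "h * exp (h/2) \<le> (1 + h) * (2 * sinh (h/2))"
    proof -
      have "(1 + h) * exp (- h) \<le> 1"
        using exp_ge_add_one_self[of h] by (simp add: exp_minus field_simps)
      then have "((1 + h) * exp (- h)) * exp (h/2) \<le> 1 * exp (h/2)" by (rule mult_right_mono) simp
      moreover have "exp (- h) * exp (h/2) = exp (- (h/2))" by (simp flip: exp_add)
      ultimately have "(1 + h) * exp (- (h/2)) \<le> exp (h/2)" by (simp add: mult.assoc)
      then show ?thesis by (simp add: sinh_field_def algebra_simps)
    qed
    have "h * (pi * cosh x * E x) \<le> h * (pi * (c * exp (h/2)) * E x)"
      using h cx by (intro mult_left_mono mult_right_mono) (auto simp: E_def)
    also have "\<dots> = pi * c * E x * (h * exp (h/2))" by simp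
    also have "\<dots> \<le> pi * c * E x * ((1 + h) * (2 * sinh (h/2)))"
      using eh c0 by (intro mult_left_mono) (auto simp: E_def)
    also have "\<dots> = (1 + h) / g * (E x * (pi * g * (sinh x - sinh (x - h))))"
      using g unfolding sd by (simp add: field_simps)
    \<comment> \<open>The inequality s <= exp s - 1 turns the increment of sinh into a difference of
      exponentials.\<close>
    also have "\<dots> \<le> (1 + h) / g * (E x * (exp (pi * g * (sinh x - sinh (x - h))) - 1))"
    proof -
      have "pi * g * (sinh x - sinh (x - h)) \<le> exp (pi * g * (sinh x - sinh (x - h))) - 1"
        using exp_ge_add_one_self[of "pi * g * (sinh x - sinh (x - h))"] by linarith
      then show ?thesis using h g by (intro mult_left_mono) (auto simp: E_def)
    qed
    also have "E x * (exp (pi * g * (sinh x - sinh (x - h))) - 1) = E (x - h) - E x"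
      by (simp add: E_def algebra_simps flip: exp_add)
    finally show ?thesis .
  qed
  moreover have "{a<..k + 1} = insert (k + 1) {a<..k}" using step by auto
  ultimately show ?case using step.IH
    unfolding E_def xh[symmetric] x_def by (simp add: algebra_simps)
qed

section \<open>The sine integral and the size of \<open>Jfun\<close>\<close>

text \<open>Up to pi the integrand lies between 0 and 1. Beyond pi, adding (cos t + 1) / t or (cos t
  - 1) / t, the boundary terms of an integration by parts, makes \<open>Si\<close> monotone in
  either direction; the first correction vanishes at pi, the second equals - 2 / pi there.\<close>

lemma abs_Si_le_pi_nonneg:
  fixes x :: real
  assumes "0 \<le> x"
  shows "\<bar>Si x\<bar> \<le> pi"
proof -
  have Si0: "Si 0 = 0" using Si_neg[of 0] by simp
  have upto: "0 \<le> Si x \<and> Si x \<le> pi" if "0 \<le> x" "x \<le> pi" for x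
  proof -
    have "Si 0 \<le> Si x"
    proof (rule DERIV_nonneg_imp_nondecreasing[OF that(1)])
      fix t assume "0 \<le> t" "t \<le> x"
      then show "\<exists>y. (Si has_real_derivative y) (at t) \<and> 0 \<le> y"
        using that by (intro exI[of _ "sinc t"] conjI DERIV_Si) (auto simp: sin_ge_zero)
    qed
    moreover have "(\<lambda>t. t - Si t) 0 \<le> (\<lambda>t. t - Si t) x"
    proof (rule DERIV_nonneg_imp_nondecreasing[OF that(1)])
      fix t assume "0 \<le> t" "t \<le> x"
      then show "\<exists>y. ((\<lambda>t. t - Si t) has_real_derivative y) (at t) \<and> 0 \<le> y"
        by (intro exI[of _ "1 - sinc t"] conjI)
          (auto intro!: derivative_eq_intros DERIV_Si simp: sin_x_le_x field_simps)
    qed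
    ultimately show ?thesis using Si0 that by simp
  qed
  show ?thesis
  proof (cases "x \<le> pi")
    case True
    then show ?thesis using upto[of x] assms by simp
  next
    case False
    then have px: "pi \<le> x" by simp
    have "(\<lambda>t. Si t + (cos t + 1) / t) pi \<ge> (\<lambda>t. Si t + (cos t + 1) / t) x"
    proof (rule DERIV_nonpos_imp_nonincreasing[OF px])
      fix t assume t: "pi \<le> t" "t \<le> x"
      then have t0: "t > 0" using pi_gt_zero by linarith
      have "((\<lambda>t. Si t + (cos t + 1) / t) has_real_derivative (- (cos t + 1) / t\<^sup>2)) (at t)"
        using t0 by (auto intro!: derivative_eq_intros DERIV_Si simp: power2_eq_square field_simps)
      moreover have "- (cos t + 1) / t\<^sup>2 \<le> 0"
        using cos_ge_minus_one[of t] by (simp add: divide_nonpos_nonneg)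
      ultimately show "\<exists>y. ((\<lambda>t. Si t + (cos t + 1) / t) has_real_derivative y) (at t) \<and> y \<le> 0" by blast
    qed
    moreover have "0 \<le> (cos x + 1) / x" using cos_ge_minus_one[of x] assms by (intro divide_nonneg_nonneg) linarith+
    ultimately have 1: "Si x \<le> pi" using upto[of pi] by simp
    have "(\<lambda>t. Si t + (cos t - 1) / t) pi \<le> (\<lambda>t. Si t + (cos t - 1) / t) x"
    proof (rule DERIV_nonneg_imp_nondecreasing[OF px])
      fix t assume t: "pi \<le> t" "t \<le> x"
      then have t0: "t > 0" using pi_gt_zero by linarith
      have "((\<lambda>t. Si t + (cos t - 1) / t) has_real_derivative ((1 - cos t) / t\<^sup>2)) (at t)"
        using t0 by (auto intro!: derivative_eq_intros DERIV_Si simp: power2_eq_square field_simps)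
      moreover have "0 \<le> (1 - cos t) / t\<^sup>2" by simp
      ultimately show "\<exists>y. ((\<lambda>t. Si t + (cos t - 1) / t) has_real_derivative y) (at t) \<and> 0 \<le> y" by blast
    qed
    moreover have "(cos x - 1) / x \<le> 0" using assms by (simp add: divide_nonpos_nonneg)
    ultimately have 2: "- 2 / pi \<le> Si x" using upto[of pi] by simp
    have "2 / pi \<le> 2 / 1" using pi_gt3 by (intro divide_left_mono) auto
    then have "2 / pi \<le> pi" using pi_gt3 by simp
    with 1 2 show ?thesis by simp
  qed
qed

lemma abs_Si_le_pi: "\<bar>Si x\<bar> \<le> pi"
proof (cases "0 \<le> x")
  case False
  then have "Si x = - Si (- x)" using Si_neg[of "- x"] by simp
  with False abs_Si_le_pi_nonneg[of "- x"] show ?thesis by simp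
qed (rule abs_Si_le_pi_nonneg)

lemma abs_Jfun_le: "0 \<le> h \<Longrightarrow> \<bar>Jfun k h x\<bar> \<le> 3/2 * h"
proof -
  assume h: "0 \<le> h"
  define s where "s = Si (pi * (x / h - real_of_int k)) / pi"
  have "\<bar>s\<bar> \<le> 1" using abs_Si_le_pi by (simp add: s_def abs_divide)
  then have "\<bar>1/2 + s\<bar> \<le> 3/2" unfolding abs_le_iff by auto
  from mult_left_mono[OF this h] show ?thesis using h by (simp add: Jfun_def s_def abs_mult mult.commute)
qed

section \<open>The numerical inequality behind the truncation constant\<close>

text \<open>Applied with X = d n and L = log (2 d n / mu). The exponent on the right splits as pi (1
  - alpha) / 12 + pi (alpha + beta) / 2. The first part pays for (3/2) powr (1 - alpha); of the
  second, pi nu / 5 pays for the term with nu^2, and the rest, with the surplus pi X (1 - 1/L), for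
  the factor X (1 + 1/L).\<close>

lemma tail_constant_le:
  fixes L \<mu> \<alpha> \<beta> \<nu> X h :: real
  assumes L: "1 \<le> L" and mu: "0 < \<mu>" "\<mu> \<le> \<alpha>" "\<mu> \<le> \<beta>" and a1: "\<alpha> \<le> 1"
    and nu: "0 < \<nu>" "\<nu> \<le> \<alpha> + \<beta>" and X: "X = \<mu> * exp L / 2" "\<nu> * exp 1 / 2 \<le> X"
    and h: "0 < h" "h \<le> L"
  shows "3/2 * (3/2) powr (1 - \<alpha>) * (1 + h) * (X / L) * exp (- (pi * X) + pi * \<nu>\<^sup>2 / (4 * X))
          \<le> exp (- (pi * X / L)) * exp (pi * (1 + 5 * \<alpha> + 6 * \<beta>) / 12)"
proof -
  have e27: "27/10 \<le> exp (1::real)"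
  proof -
    have "1 + 1/8 + (1/8)\<^sup>2/2 \<le> exp (1/8::real)" by (rule exp_lower_Taylor_quadratic) simp
    then have "(1 + 1/8 + (1/8)\<^sup>2/2) ^ 8 \<le> exp (1/8::real) ^ 8" by (intro power_mono) auto
    also have "exp (1/8::real) ^ 8 = exp 1" by (simp flip: exp_of_nat_mult)
    finally show ?thesis by (simp add: power2_eq_square power_divide)
  qed
  have e272: "exp (1::real) \<le> 272/100" using e_less_272 by simp
  have X0: "0 < X" unfolding X(1) using mu by simp
  define s where "s = 1 - \<alpha>"
  have s: "0 \<le> s" "s \<le> 1" using a1 mu by (auto simp: s_def)
  \<comment> \<open>exp (pi/12) >= exp (1/4) covers 3/2 up to the factor 1172/1000. Together with
    the leading 3/2 this makes the 1758/1000 below.\<close>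
  have p32: "(3/2) powr s \<le> 1172/1000 * exp (pi * s / 12)"
  proof -
    have "1 + 1/4 + (1/4)\<^sup>2/2 \<le> exp (1/4::real)" by (rule exp_lower_Taylor_quadratic) simp
    also have "exp (1/4::real) \<le> exp (pi/12)" using pi_gt3 by simp
    finally have "3/2 \<le> 1172/1000 * exp (pi/12)" by (simp add: power2_eq_square)
    then have "(3/2) powr s \<le> (1172/1000 * exp (pi/12)) powr s" using s by (intro powr_mono2) auto
    also have "\<dots> = (1172/1000) powr s * exp (pi * s / 12)"
      unfolding powr_mult by (simp add: powr_def mult.commute)
    also have "\<dots> \<le> (1172/1000) powr 1 * exp (pi * s / 12)"
      using s by (intro mult_right_mono powr_mono) auto
    finally show ?thesis by simp
  qed
  \<comment> \<open>The lower bound X >= nu e / 2 is used in the form X >= 5/4 nu.\<close>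
  have nuX: "pi * \<nu>\<^sup>2 / (4 * X) \<le> pi * (\<nu> / 5)"
  proof -
    have "\<nu> * (27/10) \<le> \<nu> * exp 1" using e27 nu by (intro mult_left_mono) auto
    then have "5/4 * \<nu> \<le> X" using nu X(2) by linarith
    then have "5/4 * \<nu> * \<nu> \<le> X * \<nu>" using nu by (intro mult_right_mono) auto
    then have "\<nu>\<^sup>2 / (4 * X) \<le> \<nu> / 5" using X0 nu by (simp add: field_simps power2_eq_square)
    then have "pi * (\<nu>\<^sup>2 / (4 * X)) \<le> pi * (\<nu> / 5)" by (rule mult_left_mono) simp
    then show ?thesis by simp
  qed
  define y where "y = exp L / 2"
  have y0: "0 < y" by (simp add: y_def)
  have Xy: "X = \<mu> * y" by (simp add: X y_def)
  \<comment> \<open>Writing X = mu * y leaves an inequality in L alone. It is nearly sharp at L = 1,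
    where the sides are about 4.78 and 4.86. Collecting the multiples of exp L gives the form proved
    first; its left side is positive only for L below 1.56, where exp L <= e / (1 - t) is good
    enough.\<close>
  have key: "1758/1000 * (y * (1 + 1/L)) \<le> 27/10 * (18/10 + 3 * y * (1 - 1/L))"
  proof -
    define t where "t = L - 1"
    have t0: "0 \<le> t" using L by (simp add: t_def)
    have Lt: "L = 1 + t" by (simp add: t_def)
    have "exp L * (9858/1000 - 6342/1000 * L) \<le> 972/100 * L"
    proof (cases "t < 1 \<and> 9858/1000 - 6342/1000 * L \<ge> 0")
      case True
      have "1 - t \<le> exp (- t)" using exp_ge_add_one_self[of "- t"] by simp
      then have "exp L * (1 - t) \<le> exp L * exp (- t)" by (intro mult_left_mono) auto
      also have "\<dots> = exp 1" by (simp add: Lt flip: exp_add)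
      finally have "exp L \<le> (272/100) / (1 - t)" using e272 True by (simp add: field_simps)
      then have "exp L * (9858/1000 - 6342/1000 * L) \<le> (272/100) / (1 - t) * (9858/1000 - 6342/1000 * L)"
        using True by (intro mult_right_mono) auto
      also have "\<dots> \<le> 972/100 * L"
      proof -
        have "t * t \<le> t" using True t0 by (simp add: mult_left_le)
        then show ?thesis using True t0 unfolding Lt by (simp add: field_simps)
      qed
      finally show ?thesis .
    next
      case False
      then have "9858/1000 - 6342/1000 * L \<le> 0" using L by (auto simp: t_def)
      then have "exp L * (9858/1000 - 6342/1000 * L) \<le> 0" by (simp add: mult_nonneg_nonpos)
      also have "0 \<le> 972/100 * L" using L by simp
      finally show ?thesis .
    qed
    then have "exp L * (9858/1000 - 6342/1000 * L) * (1/L) \<le> 972/100 * L * (1/L)"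
      using L by (intro mult_right_mono) auto
    also have "exp L * (9858/1000 - 6342/1000 * L) * (1/L) = 9858/1000 * (exp L * (1/L)) - 6342/1000 * exp L"
      using L by (simp add: field_simps)
    finally have "9858/1000 * (exp L * (1/L)) - 6342/1000 * exp L \<le> 972/100" using L by simp
    then show ?thesis unfolding y_def ring_distribs by simp
  qed
  define c where "c = 18/10 + 3 * y * (1 - 1/L)"
  have c0: "0 \<le> 1 - 1/L" using L by simp
  \<comment> \<open>The tangent of exp at 1: e * x <= exp x with x = mu * c, and 27/10 bounds e from
    below.\<close>
  have ex: "1758/1000 * X * (1 + 1/L) \<le> exp (\<mu> * c)"
  proof -
    have "1758/1000 * X * (1 + 1/L) = \<mu> * (1758/1000 * (y * (1 + 1/L)))" by (simp add: Xy)
    also have "\<dots> \<le> \<mu> * (27/10 * c)" unfolding c_def using key mu by (intro mult_left_mono) auto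
    also have "\<dots> = 27/10 * (\<mu> * c)" by simp
    also have "\<dots> \<le> exp 1 * (\<mu> * c)"
      using e27 mu c0 y0 by (intro mult_right_mono) (auto simp: c_def)
    also have "\<dots> \<le> exp 1 * exp (\<mu> * c - 1)"
      using exp_ge_add_one_self[of "\<mu> * c - 1"] by (intro mult_left_mono) auto
    finally show ?thesis by (simp flip: exp_add)
  qed
  \<comment> \<open>Origin of 18/10: as nu <= alpha + beta, at least 3/10 (alpha + beta) >= 6/10 mu
    remains after reserving nu / 5, and pi > 3.\<close>
  have muc: "\<mu> * c \<le> pi * ((\<alpha> + \<beta>) / 2 - \<nu> / 5) + pi * X * (1 - 1/L)"
  proof -
    have "\<mu> * (18/10) \<le> 3 * ((\<alpha> + \<beta>) / 2 - \<nu> / 5)" using mu nu by argo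
    also have "\<dots> \<le> pi * ((\<alpha> + \<beta>) / 2 - \<nu> / 5)" using pi_gt3 mu nu by (intro mult_right_mono) auto
    finally have "\<mu> * (18/10) \<le> pi * ((\<alpha> + \<beta>) / 2 - \<nu> / 5)" .
    moreover have "3 * (X * (1 - 1/L)) \<le> pi * (X * (1 - 1/L))"
      using pi_gt3 X0 c0 by (intro mult_right_mono) auto
    moreover have "\<mu> * c = \<mu> * (18/10) + 3 * (X * (1 - 1/L))"
      unfolding c_def Xy by (simp add: distrib_left mult_ac)
    ultimately show ?thesis by (simp only: mult.assoc)
  qed
  have "(1 + h) * (X / L) \<le> (1 + L) * (X / L)" using h X0 L by (intro mult_right_mono) auto
  also have "\<dots> = X * (1 + 1/L)" using L by (simp add: field_simps)
  finally have hX: "(1 + h) * (X / L) \<le> X * (1 + 1/L)" .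
  have "3/2 * (3/2) powr s * (1 + h) * (X / L) * exp (- (pi * X) + pi * \<nu>\<^sup>2 / (4 * X))
      = 3/2 * (3/2) powr s * ((1 + h) * (X / L)) * exp (- (pi * X) + pi * \<nu>\<^sup>2 / (4 * X))" by simp
  also have "\<dots> \<le> 3/2 * (1172/1000 * exp (pi * s / 12)) * (X * (1 + 1/L)) * exp (- (pi * X) + pi * (\<nu> / 5))"
  proof -
    define P P' where "P = (1 + h) * (X / L)" and "P' = X * (1 + 1/L)"
    have "0 \<le> P" "P \<le> P'" using hX X0 L h by (auto simp: P_def P'_def)
    then show ?thesis unfolding P_def[symmetric] P'_def[symmetric]
      using p32 nuX by (intro mult_mono) auto
  qed
  also have "\<dots> = (1758/1000 * X * (1 + 1/L)) * (exp (pi * s / 12) * exp (- (pi * X) + pi * (\<nu> / 5)))" by simp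
  also have "\<dots> \<le> exp (pi * ((\<alpha> + \<beta>) / 2 - \<nu> / 5) + pi * X * (1 - 1/L)) *
                (exp (pi * s / 12) * exp (- (pi * X) + pi * (\<nu> / 5)))"
    using order_trans[OF ex, of "exp (pi * ((\<alpha> + \<beta>) / 2 - \<nu> / 5) + pi * X * (1 - 1/L))"] muc
    by (intro mult_right_mono) auto
  also have "\<dots> = exp (- (pi * X / L)) * exp (pi * (1 + 5 * \<alpha> + 6 * \<beta>) / 12)"
    by (simp add: s_def algebra_simps add_divide_distrib diff_divide_distrib flip: exp_add)
  finally show ?thesis by (simp add: s_def)
qed

subsection \<open>Sinc indefinite integration on a strip\<close>

lemma open_strip: "open (strip d)"
  unfolding strip_def by (intro open_Collect_less continuous_intros)

lemma Jfun_has_derivative: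
  assumes "h \<noteq> 0"
  shows "(Jfun k h has_real_derivative sinc (pi * (x / h - real_of_int k))) (at x)"
proof -
  have "((\<lambda>x. Si (pi * (x / h - real_of_int k))) has_real_derivative
          sinc (pi * (x / h - real_of_int k)) * (pi * (1 / h))) (at x)"
    by (rule DERIV_chain2[OF DERIV_Si]) (use assms in \<open>auto intro!: derivative_eq_intros\<close>)
  then have "((\<lambda>x. h * (1/2 + Si (pi * (x / h - real_of_int k)) / pi)) has_real_derivative
          h * (sinc (pi * (x / h - real_of_int k)) * (pi * (1 / h)) / pi)) (at x)"
    by (auto intro!: derivative_eq_intros)
  then show ?thesis using assms unfolding Jfun_def[abs_def] by simp
qed

lemma sinc_has_integral_Jfun:
  assumes "h \<noteq> 0" "a \<le> b"
  shows "((\<lambda>t. sinc (pi * (t / h - real_of_int k))) has_integral (Jfun k h b - Jfun k h a)) {a..b}"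
  using assms
  by (intro fundamental_theorem_of_calculus has_field_derivative_at_within
      Jfun_has_derivative[unfolded has_real_derivative_iff_has_vector_derivative]
      has_vector_derivative_at_within)

text \<open>The summand 1/2 in \<open>Jfun\<close> offsets the limit - pi/2 of \<open>Si\<close>.
  Integrals over {a..x} produce increments \<open>Jfun k h x - Jfun k h a\<close>; letting a tend to
  - infinity leaves \<open>Jfun k h x\<close>.\<close>

lemma Jfun_tendsto_0:
  assumes "0 < h"
  shows "(Jfun k h \<longlongrightarrow> 0) at_bot"
proof -
  have "((\<lambda>x. Si (- (pi * (x / h - real_of_int k)))) \<longlongrightarrow> pi/2) at_bot"
  proof (rule filterlim_compose[OF Si_at_top])
    show "filterlim (\<lambda>x. - (pi * (x / h - real_of_int k))) at_top at_bot"
      using assms by real_asymp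
  qed
  then have "((\<lambda>x. h * (1/2 + (- Si (- (pi * (x / h - real_of_int k)))) / pi)) \<longlongrightarrow> h * (1/2 + (- (pi/2)) / pi)) at_bot"
    by (intro tendsto_intros) auto
  moreover have "\<forall>\<^sub>F x in at_bot. h * (1/2 + (- Si (- (pi * (x / h - real_of_int k)))) / pi) = Jfun k h x"
    using eventually_le_at_bot[of "real_of_int k * h"]
  proof eventually_elim
    case (elim x)
    then have "0 \<le> - (pi * (x / h - real_of_int k))" 
      using assms by (simp add: mult_nonneg_nonpos field_simps)
    from Si_neg[OF this] show ?case by (simp add: Jfun_def)
  qed
  ultimately show ?thesis by (auto dest: Lim_transform_eventually)
qed

lemma cos_pi_of_int_squared [simp]: "cos (pi * real_of_int k) * cos (pi * real_of_int k) = 1"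
  using sin_cos_squared_add[of "pi * real_of_int k"] by (simp add: power2_eq_square)

text \<open>The left side is sin (pi t / h) times the residue of 1 / ((z - t) sin (pi z / h)) at the
  node z = k h, where the derivative of the sine is pi / h cos (pi k).\<close>

lemma sinc_shift:
  fixes t h :: real
  assumes "0 < h" "t \<noteq> real_of_int k * h"
  shows "sin (pi * t / h) / ((real_of_int k * h - t) * (pi / h * cos (pi * real_of_int k))) = - sinc (pi * (t / h - real_of_int k))"
proof -
  have ne: "t / h - real_of_int k \<noteq> 0" using assms by (auto simp: field_simps)
  have "sin (pi * (t / h - real_of_int k)) = sin (pi * t / h) * cos (pi * real_of_int k)"
    by (simp add: right_diff_distrib sin_diff)
  then have "sin (pi * t / h) = sin (pi * (t / h - real_of_int k)) * cos (pi * real_of_int k)"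
    by (simp add: mult.assoc)
  then have "sin (pi * t / h) / ((real_of_int k * h - t) * (pi / h * cos (pi * real_of_int k)))
     = sin (pi * (t / h - real_of_int k)) / ((real_of_int k * h - t) * (pi / h))"
    by (metis (no_types, opaque_lifting) cos_pi_of_int_squared mult.assoc mult_divide_mult_cancel_right mult_zero_left zero_neq_one)
  also have "(real_of_int k * h - t) * (pi / h) = - (pi * (t / h - real_of_int k))"
    using assms by (simp add: field_simps)
  finally show ?thesis using ne by simp
qed

section \<open>The sinc interpolation error as a contour integral\<close>

lemma cmod_sin_sq: "(cmod (sin z))\<^sup>2 = (sin (Re z))\<^sup>2 + (sinh (Im z))\<^sup>2"
proof -
  have re: "Re (sin z) = sin (Re z) * cosh (Im z)"
    by (simp add: Re_sin cosh_field_def algebra_simps)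
  have im: "Im (sin z) = cos (Re z) * sinh (Im z)"
    by (simp add: Im_sin sinh_field_def algebra_simps)
  have "(cmod (sin z))\<^sup>2 = (sin (Re z))\<^sup>2 * (cosh (Im z))\<^sup>2 + (cos (Re z))\<^sup>2 * (sinh (Im z))\<^sup>2"
    unfolding cmod_power2 re im by (simp add: power_mult_distrib)
  also have "\<dots> = (sin (Re z))\<^sup>2 + ((sin (Re z))\<^sup>2 + (cos (Re z))\<^sup>2) * (sinh (Im z))\<^sup>2"
    unfolding cosh_square_eq by (simp only: ring_distribs mult_1_right)
  finally show ?thesis by simp
qed

lemma cmod_sin_ge_abs_sinh: "\<bar>sinh (Im z)\<bar> \<le> cmod (sin z)"
proof (rule power2_le_imp_le)
  show "\<bar>sinh (Im z)\<bar>\<^sup>2 \<le> (cmod (sin z))\<^sup>2" unfolding cmod_sin_sq power2_abs by simp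
qed simp

text \<open>Meant for the vertical sides of the rectangle: placing them at the abscissae (m + 1/2) h
  and - (m + 1/2) h keeps 1 / sin (pi z / h) bounded by 1 on them.\<close>

lemma cmod_sin_ge_one:
  assumes "(sin (Re z))\<^sup>2 = 1"
  shows "1 \<le> cmod (sin z)"
  by (rule power2_le_imp_le) (auto simp: cmod_sin_sq assms)

lemma sin_half_integer_sq: "(sin (pi * (real m + 1/2)))\<^sup>2 = 1"
proof -
  have "sin (pi * (real m + 1/2)) = cos (pi * real m)"
    by (simp add: distrib_left sin_add)
  then show ?thesis
    using cos_pi_of_int_squared[of "int m"] by (simp add: power2_eq_square)
qed

lemma sin_scaled_eq_0_iff:
  fixes h :: real and z :: complex
  assumes "h \<noteq> 0"
  shows "sin (of_real pi * z / of_real h) = 0 \<longleftrightarrow> (\<exists>k::int. z = of_real (real_of_int k * h))"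
proof
  assume "sin (of_real pi * z / of_real h) = 0"
  then obtain k :: int where "of_real pi * z / of_real h = of_real (of_int k * pi)"
    using sin_eq_0 by blast
  then have "z = of_real (real_of_int k * h)" using assms by (simp add: field_simps)
  then show "\<exists>k::int. z = of_real (real_of_int k * h)" by blast
next
  assume "\<exists>k::int. z = of_real (real_of_int k * h)"
  then obtain k :: int where "z = of_real (real_of_int k * h)" by blast
  then have "of_real pi * z / of_real h = of_real (of_int k * pi)" using assms by (simp add: field_simps)
  then show "sin (of_real pi * z / of_real h) = 0" by (auto simp: sin_eq_0)
qed

lemma sinc_interpolation_contour:
  fixes F :: "complex \<Rightarrow> complex" and h e d t :: real and m :: nat
  defines "R \<equiv> (real m + 1/2) * h"
  assumes h: "0 < h" and e: "0 < e" "e < d" and F: "F holomorphic_on strip d"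
    and t: "\<bar>t\<bar> < R" "\<And>k::int. t \<noteq> real_of_int k * h"
  shows "of_real (sin (pi * t / h)) *
           contour_integral (rectpath (Complex (-R) (-e)) (Complex R e))
             (\<lambda>z. F z / ((z - of_real t) * sin (of_real pi * z / of_real h)))
         = 2 * of_real pi * \<i> * (F (of_real t)
             - (\<Sum>k=-int m..int m. F (of_real (real_of_int k * h)) * of_real (sinc (pi * (t / h - real_of_int k)))))"
proof -
  define f where "f = (\<lambda>z. F z / ((z - of_real t) * sin (of_real pi * z / of_real h)))"
  \<comment> \<open>Slightly larger than the rectangle, but its half width (m + 1) h stops just
    short of the next zeros of the sine. So all poles in \<open>S\<close> are enclosed by the
    contour, with winding number 1.\<close>
  define S where "S = box (Complex (- ((real m + 1) * h)) (-d)) (Complex ((real m + 1) * h) d)"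
  define q where "q = (\<lambda>k::int. complex_of_real (real_of_int k * h))"
  define K where "K = {-int m..int m}"
  define \<gamma> where "\<gamma> = rectpath (Complex (-R) (-e)) (Complex R e)"
  have R0: "0 < R" using h by (simp add: R_def)
  have RS: "R < (real m + 1) * h" using h by (simp add: R_def)
  have S: "open S" "connected S" by (auto simp: S_def convex_connected)
  have Sstrip: "S \<subseteq> strip d" by (auto simp: S_def strip_def in_box_complex_iff)
  have injq: "inj q" using h by (auto simp: inj_def q_def)
  have tq: "of_real t \<noteq> q k" for k using t(2)[of k] unfolding q_def of_real_eq_iff .
  have sin0: "sin (of_real pi * z / of_real h) = 0 \<longleftrightarrow> (\<exists>k. z = q k)" for z
    using sin_scaled_eq_0_iff[of h z] h by (auto simp: q_def)
  have qS: "k \<in> K" if "q k \<in> S" for k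
  proof -
    have "\<bar>real_of_int k\<bar> * h < (real m + 1) * h"
      using that h by (auto simp: S_def q_def in_box_complex_iff abs_less_iff algebra_simps abs_if)
    then have "\<bar>real_of_int k\<bar> < real m + 1" using h by simp
    then show ?thesis by (auto simp: K_def)
  qed
  have Kq: "\<bar>real_of_int k * h\<bar> < R" if "k \<in> K" for k
  proof -
    have "\<bar>real_of_int k\<bar> \<le> real m" using that by (auto simp: K_def)
    then have "\<bar>real_of_int k\<bar> * h < (real m + 1/2) * h" using h by (intro mult_strict_right_mono) auto
    then show ?thesis using h by (simp add: R_def abs_mult)
  qed
  have realbox: "of_real u \<in> box (Complex (-R) (-e)) (Complex R e)" if "\<bar>u\<bar> < R" for u
    using that e by (auto simp: in_box_complex_iff)
  have boxS: "cbox (Complex (-R) (-e)) (Complex R e) \<subseteq> S"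
    using RS e by (auto simp: S_def in_box_complex_iff in_cbox_complex_iff)
  define pts where "pts = insert (of_real t) (q ` K)"
  have fin: "finite pts" by (simp add: pts_def K_def)
  have pbox: "pts \<subseteq> box (Complex (-R) (-e)) (Complex R e)"
    unfolding pts_def q_def using realbox Kq t(1) by blast
  have pS: "pts \<subseteq> S" using pbox boxS box_subset_cbox by blast
  have FS: "F holomorphic_on S" using F Sstrip by (rule holomorphic_on_subset)
  have sin_ne: "sin (of_real pi * z / of_real h) \<noteq> 0" if "z \<in> S" "z \<notin> q ` K" for z
    using sin0[of z] qS that by auto
  have holo: "f holomorphic_on S - pts"
    unfolding f_def by (intro holomorphic_intros holomorphic_on_subset[OF FS]) (auto simp: pts_def sin_ne)
  have gS: "path_image \<gamma> \<subseteq> S - pts"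
    using R0 e boxS pbox unfolding \<gamma>_def
    by (subst path_image_rectpath_cbox_minus_box) auto
  have res: "residue f (q k) = F (q k) / ((q k - of_real t) * of_real (pi / h * cos (pi * real_of_int k)))"
    if k: "k \<in> K" for k
  proof -
    have op: "open (S - (pts - {q k}))" using S fin by (intro open_Diff finite_imp_closed) auto
    show ?thesis
    proof (rule residue_simple'[OF op])
      show "q k \<in> S - (pts - {q k})" using k pS by (auto simp: pts_def)
      show "f holomorphic_on S - (pts - {q k}) - {q k}"
        by (rule holomorphic_on_subset[OF holo]) auto
      have qkS: "q k \<in> S" using k pS by (auto simp: pts_def)
      have "((\<lambda>w. sin (of_real pi * w / of_real h)) has_field_derivative
              cos (of_real pi * q k / of_real h) * (of_real pi / of_real h)) (at (q k))"
        using h by (auto intro!: derivative_eq_intros)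
      moreover have "of_real pi * q k / of_real h = complex_of_real (pi * real_of_int k)"
        using h by (simp add: q_def)
      then have "cos (of_real pi * q k / of_real h) = complex_of_real (cos (pi * real_of_int k))"
        by (simp only: cos_of_real)
      moreover have "sin (of_real pi * q k / of_real h) = 0" using sin0 by blast
      ultimately have lim: "((\<lambda>w. sin (of_real pi * w / of_real h) / (w - q k)) \<longlongrightarrow>
          of_real (pi / h * cos (pi * real_of_int k))) (at (q k))"
        by (simp add: has_field_derivative_iff mult.commute)
      have ne: "complex_of_real (pi / h * cos (pi * real_of_int k)) \<noteq> 0"
        using cos_pi_of_int_squared[of k] h unfolding of_real_eq_0_iff by auto
      have "isCont F (q k)"
        using FS S qkS by (auto simp: holomorphic_on_open isCont_def dest!: DERIV_isCont)
      then have "((\<lambda>w. F w / (w - of_real t)) \<longlongrightarrow> F (q k) / (q k - of_real t)) (at (q k))"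
        using tq[of k] by (intro tendsto_intros) (auto simp: isCont_def)
      from tendsto_divide[OF this lim ne]
      have "((\<lambda>w. F w / (w - of_real t) / (sin (of_real pi * w / of_real h) / (w - q k))) \<longlongrightarrow>
         F (q k) / (q k - of_real t) / of_real (pi / h * cos (pi * real_of_int k))) (at (q k))" .
      then show "((\<lambda>w. f w * (w - q k)) \<longlongrightarrow>
         F (q k) / ((q k - of_real t) * of_real (pi / h * cos (pi * real_of_int k)))) (at (q k))"
        by (simp add: f_def)
    qed
  qed
  have "contour_integral \<gamma> f = 2 * pi * \<i> * (\<Sum>p\<in>pts. winding_number \<gamma> p * residue f p)"
  proof (rule Residue_theorem[OF S fin holo _ _ gS])
    show "\<forall>z. z \<notin> S \<longrightarrow> winding_number \<gamma> z = 0"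
      unfolding \<gamma>_def using R0 e boxS by (auto intro!: winding_number_rectpath_outside)
  qed (auto simp: \<gamma>_def)
  also have "(\<Sum>p\<in>pts. winding_number \<gamma> p * residue f p) = (\<Sum>p\<in>pts. residue f p)"
    using pbox by (intro sum.cong) (auto simp: \<gamma>_def winding_number_rectpath subset_iff)
  also have "\<dots> = residue f (of_real t) + (\<Sum>k\<in>K. residue f (q k))"
    unfolding pts_def using tq injq
    by (subst sum.insert) (auto simp: K_def sum.reindex inj_on_subset[OF injq])
  also have "residue f (of_real t) = F (of_real t) / sin (of_real pi * of_real t / of_real h)"
  proof -
    have op: "open (S - q ` K)" using S by (intro open_Diff finite_imp_closed) (auto simp: K_def)
    have "residue (\<lambda>w. (F w / sin (of_real pi * w / of_real h)) / (w - of_real t)) (of_real t)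
            = F (of_real t) / sin (of_real pi * of_real t / of_real h)"
      by (rule residue_simple[OF op])
        (use pS tq in \<open>auto simp: pts_def sin_ne intro!: holomorphic_intros holomorphic_on_subset[OF FS]\<close>)
    moreover have "f = (\<lambda>w. (F w / sin (of_real pi * w / of_real h)) / (w - of_real t))"
      by (simp add: f_def mult.commute)
    ultimately show ?thesis by simp
  qed
  finally have *: "contour_integral \<gamma> f = 2 * pi * \<i> * (F (of_real t) / sin (of_real pi * of_real t / of_real h)
       + (\<Sum>k\<in>K. F (q k) / ((q k - of_real t) * of_real (pi / h * cos (pi * real_of_int k)))))"
    by (simp add: res cong: sum.cong)
  define s where "s = sin (pi * t / h)"
  have s1: "sin (of_real pi * of_real t / of_real h) = complex_of_real s"
    by (simp add: s_def flip: sin_of_real)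
  have "complex_of_real s \<noteq> 0" using sin0[of "of_real t"] tq unfolding s1 by auto
  then have "of_real s * contour_integral \<gamma> f = 2 * pi * \<i> * (F (of_real t)
       + (\<Sum>k\<in>K. of_real s * (F (q k) / ((q k - of_real t) * of_real (pi / h * cos (pi * real_of_int k))))))"
    unfolding * s1 by (simp add: field_simps sum_distrib_left)
  also have "(\<Sum>k\<in>K. of_real s * (F (q k) / ((q k - of_real t) * of_real (pi / h * cos (pi * real_of_int k)))))
     = (\<Sum>k\<in>K. - (F (q k) * of_real (sinc (pi * (t / h - real_of_int k)))))"
  proof (rule sum.cong[OF refl])
    fix k
    have "of_real s * (F (q k) / ((q k - of_real t) * of_real (pi / h * cos (pi * real_of_int k))))
        = F (q k) * of_real (s / ((real_of_int k * h - t) * (pi / h * cos (pi * real_of_int k))))"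
      by (simp add: q_def)
    also have "\<dots> = F (q k) * of_real (- sinc (pi * (t / h - real_of_int k)))"
      unfolding s_def sinc_shift[OF h t(2)] ..
    finally show "of_real s * (F (q k) / ((q k - of_real t) * of_real (pi / h * cos (pi * real_of_int k))))
        = - (F (q k) * of_real (sinc (pi * (t / h - real_of_int k))))" by simp
  qed
  finally show ?thesis by (simp add: \<gamma>_def f_def s_def K_def q_def sum_negf)
qed

section \<open>The horizontal sides, integrated over t\<close>

text \<open>Integration by parts with the primitive - h / pi cos (pi t / h) of the sine. The lower
  boundary term vanishes by the choice of \<open>a\<close>, the upper one is at most h / (pi |Im
  z|), and what remains is at most h / pi times the integral of 1 / |z - t|^2 over the whole line,
  which is pi / |Im z|.\<close>

lemma norm_integral_sin_kernel_le:
  fixes a x h :: real and z :: complex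
  assumes h: "0 < h" and ax: "a \<le> x" and a: "cos (pi * a / h) = 0" and z: "Im z \<noteq> 0"
  shows "cmod (integral {a..x} (\<lambda>t. of_real (sin (pi * t / h)) / (z - of_real t)))
           \<le> h / \<bar>Im z\<bar> * (1 + 1 / pi)"
proof -
  define e where "e = \<bar>Im z\<bar>"
  have e: "0 < e" using z by (simp add: e_def)
  have zt: "z - of_real t \<noteq> 0" for t using z by (auto simp: complex_eq_iff)
  have ge: "e \<le> cmod (z - of_real t)" for t
    using abs_Im_le_cmod[of "z - of_real t"] by (simp add: e_def)
  define G where "G = (\<lambda>t. - of_real (h / pi * cos (pi * t / h)) / (z - of_real t))"
  define r where "r = (\<lambda>t. of_real (h / pi * cos (pi * t / h)) / (z - of_real t)\<^sup>2)"
  have int_r: "r integrable_on {a..x}"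
    unfolding r_def using zt h by (intro integrable_continuous_interval continuous_intros) auto
  have "((\<lambda>t. of_real (sin (pi * t / h)) / (z - of_real t) - r t) has_integral (G x - G a)) {a..x}"
  proof (rule fundamental_theorem_of_calculus[OF ax])
    fix t assume "t \<in> {a..x}"
    have d1: "((\<lambda>t. complex_of_real (h / pi * cos (pi * t / h))) has_vector_derivative
            of_real (- sin (pi * t / h))) (at t within {a..x})"
      by (rule has_vector_derivative_of_real) (use h in \<open>auto intro!: derivative_eq_intros simp: has_real_derivative_iff_has_vector_derivative[symmetric]\<close>)
    have d2: "((\<lambda>t. inverse (z - of_real t)) has_vector_derivative (1 / (z - of_real t)\<^sup>2)) (at t within {a..x})"
    proof -
      have "((\<lambda>w. inverse (z - w)) has_field_derivative (1 / (z - of_real t)\<^sup>2)) (at (of_real t))"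
        using zt[of t] by (auto intro!: derivative_eq_intros simp: power2_eq_square field_simps)
      then have "((\<lambda>w. inverse (z - of_real w)) has_vector_derivative (1 / (z - of_real t)\<^sup>2)) (at t within {a..x})"
        by (rule has_vector_derivative_real_field)
      then show ?thesis .
    qed
    have "(G has_vector_derivative (- (of_real (h / pi * cos (pi * t / h)) * (1 / (z - of_real t)\<^sup>2)
            + of_real (- sin (pi * t / h)) * inverse (z - of_real t)))) (at t within {a..x})"
      unfolding G_def minus_divide_left[symmetric] divide_inverse[of "complex_of_real _"]
      by (rule has_vector_derivative_minus[OF has_vector_derivative_mult[OF d1 d2]])
    then show "(G has_vector_derivative (of_real (sin (pi * t / h)) / (z - of_real t) - r t)) (at t within {a..x})"
      by (simp add: r_def divide_inverse)
  qed
  from has_integral_add[OF this integrable_integral[OF int_r]]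
  have eq: "integral {a..x} (\<lambda>t. of_real (sin (pi * t / h)) / (z - of_real t)) = G x - G a + integral {a..x} r"
    by (simp add: integral_unique)
  have "G a = 0" by (simp add: G_def a)
  have Gx: "cmod (G x) \<le> h / pi / e"
  proof -
    have "cmod (G x) = \<bar>h / pi * cos (pi * x / h)\<bar> / cmod (z - of_real x)"
      by (simp only: G_def norm_divide norm_minus_cancel norm_of_real)
    also have "\<dots> \<le> (h / pi) / e"
    proof (rule frac_le)
      show "\<bar>h / pi * cos (pi * x / h)\<bar> \<le> h / pi"
        using h mult_left_mono[OF abs_cos_le_one, of "h / pi" "pi * x / h"] by (simp add: abs_mult)
    qed (use h e ge in auto)
    finally show ?thesis .
  qed
  have hi: "((\<lambda>t. h / pi * (1 / ((t - Re z)\<^sup>2 + e\<^sup>2))) has_integral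
      (h / pi * (arctan ((x - Re z) / e) / e) - h / pi * (arctan ((a - Re z) / e) / e))) {a..x}"
  proof (rule fundamental_theorem_of_calculus[OF ax])
    fix t
    have "1 + ((t - Re z) / e)\<^sup>2 = ((t - Re z)\<^sup>2 + e\<^sup>2) / e\<^sup>2" using e by (simp add: power_divide field_simps)
    then have "inverse (1 + ((t - Re z) / e)\<^sup>2) * (1 / e) / e = 1 / ((t - Re z)\<^sup>2 + e\<^sup>2)"
      using e by (simp add: power2_eq_square)
    moreover have "((\<lambda>t. h / pi * (arctan ((t - Re z) / e) / e)) has_real_derivative
        h / pi * (inverse (1 + ((t - Re z) / e)\<^sup>2) * (1 / e) / e)) (at t within {a..x})"
      using e by (auto intro!: derivative_eq_intros simp: mult_ac)
    ultimately show "((\<lambda>t. h / pi * (arctan ((t - Re z) / e) / e)) has_vector_derivative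
        h / pi * (1 / ((t - Re z)\<^sup>2 + e\<^sup>2))) (at t within {a..x})"
      by (simp only: has_real_derivative_iff_has_vector_derivative)
  qed
  have "cmod (integral {a..x} r) \<le> integral {a..x} (\<lambda>t. h / pi * (1 / ((t - Re z)\<^sup>2 + e\<^sup>2)))"
  proof (rule integral_norm_bound_integral[OF int_r has_integral_integrable[OF hi]])
    fix t
    have "cmod (r t) = h / pi * (\<bar>cos (pi * t / h)\<bar> / (cmod (z - of_real t))\<^sup>2)"
      using h by (simp add: r_def norm_divide norm_mult norm_power abs_mult)
    also have "(cmod (z - of_real t))\<^sup>2 = (t - Re z)\<^sup>2 + e\<^sup>2"
      by (simp add: cmod_power2 e_def power2_commute)
    also have "h / pi * (\<bar>cos (pi * t / h)\<bar> / ((t - Re z)\<^sup>2 + e\<^sup>2)) \<le> h / pi * (1 / ((t - Re z)\<^sup>2 + e\<^sup>2))"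
      using h by (intro mult_left_mono divide_right_mono) auto
    finally show "cmod (r t) \<le> h / pi * (1 / ((t - Re z)\<^sup>2 + e\<^sup>2))" .
  qed
  also have "\<dots> = h / pi / e * (arctan ((x - Re z) / e) - arctan ((a - Re z) / e))"
    using integral_unique[OF hi] by (simp add: right_diff_distrib diff_divide_distrib)
  also have "\<dots> \<le> h / pi / e * pi"
    using arctan_bounded[of "(x - Re z) / e"] arctan_bounded[of "(a - Re z) / e"] h e
    by (intro mult_left_mono) auto
  also have "\<dots> = h / e" by simp
  finally have "cmod (integral {a..x} r) \<le> h / e" .
  then have "cmod (G x - G a + integral {a..x} r) \<le> h / pi / e + h / e"
    using Gx \<open>G a = 0\<close> norm_triangle_ineq[of "G x" "integral {a..x} r"] by simp
  also have "\<dots> = h / e * (1 + 1 / pi)" by (simp add: distrib_left)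
  finally show ?thesis unfolding eq e_def .
qed

text \<open>Integrand of the contour integral on the line Im z = y, multiplied by sin (pi t / h) and
  grouped so that the last factor carries all dependence on \<open>t\<close>.\<close>

definition line_kernel :: "(complex \<Rightarrow> complex) \<Rightarrow> real \<Rightarrow> real \<Rightarrow> real \<Rightarrow> real \<Rightarrow> complex" where
  "line_kernel F h y s t = F (Complex s y) / sin (of_real pi * Complex s y / of_real h)
      * (of_real (sin (pi * t / h)) / (Complex s y - of_real t))"

context
  fixes F :: "complex \<Rightarrow> complex" and h d y :: real
  assumes h: "0 < h" and y: "y \<noteq> 0" "\<bar>y\<bar> < d" and F: "F holomorphic_on strip d"
begin

lemma sin_line_ge: "sinh (pi * \<bar>y\<bar> / h) \<le> cmod (sin (of_real pi * Complex s y / of_real h))"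
proof -
  have "Im (of_real pi * Complex s y / of_real h) = pi * y / h" by simp
  moreover have "\<bar>sinh (pi * y / h)\<bar> = sinh (pi * \<bar>y\<bar> / h)"
    using h by (simp add: abs_mult flip: sinh_real_abs)
  ultimately show ?thesis
    using cmod_sin_ge_abs_sinh[of "of_real pi * Complex s y / of_real h"] by simp
qed

lemma sinh_line_pos: "0 < sinh (pi * \<bar>y\<bar> / h)"
  using h y by simp

lemma continuous_on_F_line: "continuous_on A (\<lambda>s. F (Complex s y))"
  by (rule continuous_on_compose2[OF holomorphic_on_imp_continuous_on[OF F]])
    (use y in \<open>auto simp: strip_def Complex_eq intro!: continuous_intros\<close>)

lemma line_ne: "Complex s y - of_real t \<noteq> 0" "sin (of_real pi * Complex s y / of_real h) \<noteq> 0"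
proof -
  show "Complex s y - of_real t \<noteq> 0" using y by (auto simp: complex_eq_iff)
  show "sin (of_real pi * Complex s y / of_real h) \<noteq> 0"
    using sin_line_ge[of s] sinh_line_pos by (metis leD norm_zero)
qed

lemma continuous_on_line_kernel: "continuous_on A (\<lambda>(s, t). line_kernel F h y s t)"
  unfolding line_kernel_def split_def using h line_ne
  by (intro continuous_intros continuous_on_compose2[OF continuous_on_F_line[of UNIV]])
    (auto simp: Complex_eq intro!: continuous_intros)

lemma continuous_on_line_kernel': "continuous_on A (\<lambda>(t, s). line_kernel F h y s t)"
  using continuous_on_compose2[OF continuous_on_line_kernel[of UNIV], of A "\<lambda>p. (snd p, fst p)"]
  by (simp add: split_def continuous_intros)

lemma continuous_on_integral_line_kernel:
  "continuous_on {a..b} (\<lambda>t. integral {-R..R} (\<lambda>s. line_kernel F h y s t))"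
  using integral_continuous_on_param[of "{a..b}" "-R" R "\<lambda>t s. line_kernel F h y s t"]
    continuous_on_line_kernel' by (simp add: box_real)

text \<open>The two integrals run over a compact rectangle and can be exchanged. The resulting bound
  does not depend on \<open>a\<close> or \<open>x\<close>; absolute values taken before integrating
  in \<open>t\<close> would give one that grows without limit as a tends to - infinity.\<close>

lemma norm_integral_line_kernel_le:
  assumes I: "integral {-R..R} (\<lambda>s. cmod (F (Complex s y))) \<le> I" and ax: "a \<le> x" and a: "cos (pi * a / h) = 0"
  shows "cmod (integral {a..x} (\<lambda>t. integral {-R..R} (\<lambda>s. line_kernel F h y s t)))
           \<le> h / \<bar>y\<bar> * (1 + 1 / pi) / sinh (pi * \<bar>y\<bar> / h) * I"
proof -
  define B where "B = h / \<bar>y\<bar> * (1 + 1 / pi) / sinh (pi * \<bar>y\<bar> / h)"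
  have B0: "0 \<le> B" using h sinh_line_pos by (simp add: B_def)
  have "integral {a..x} (\<lambda>t. integral {-R..R} (\<lambda>s. line_kernel F h y s t))
      = integral {-R..R} (\<lambda>s. integral {a..x} (\<lambda>t. line_kernel F h y s t))"
    using integral_swap_continuous[of a "-R" x R "\<lambda>t s. line_kernel F h y s t"] continuous_on_line_kernel'
    by (simp add: box_real)
  also have "cmod \<dots> \<le> integral {-R..R} (\<lambda>s. B * cmod (F (Complex s y)))"
  proof (rule integral_norm_bound_integral)
    have "continuous_on {-R..R} (\<lambda>s. integral (cbox a x) (line_kernel F h y s))"
      using continuous_on_line_kernel by (intro integral_continuous_on_param) 
    then show "(\<lambda>s. integral {a..x} (line_kernel F h y s)) integrable_on {-R..R}"
      by (intro integrable_continuous_interval) (simp add: box_real)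
    show "(\<lambda>s. B * cmod (F (Complex s y))) integrable_on {-R..R}"
      by (intro integrable_continuous_interval continuous_intros continuous_on_F_line)
    fix s
    have "integral {a..x} (line_kernel F h y s) = F (Complex s y) / sin (of_real pi * Complex s y / of_real h)
      * integral {a..x} (\<lambda>t. of_real (sin (pi * t / h)) / (Complex s y - of_real t))"
      unfolding line_kernel_def by (rule integral_mult_right)
    also have "cmod \<dots> = cmod (F (Complex s y)) / cmod (sin (of_real pi * Complex s y / of_real h))
      * cmod (integral {a..x} (\<lambda>t. of_real (sin (pi * t / h)) / (Complex s y - of_real t)))"
      by (simp only: norm_mult norm_divide)
    also have "\<dots> \<le> cmod (F (Complex s y)) / sinh (pi * \<bar>y\<bar> / h) * (h / \<bar>y\<bar> * (1 + 1 / pi))"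
      using sin_line_ge[of s] sinh_line_pos norm_integral_sin_kernel_le[OF h ax a, of "Complex s y"] y
      by (intro mult_mono divide_left_mono) (auto intro!: mult_pos_pos)
    finally show "cmod (integral {a..x} (line_kernel F h y s)) \<le> B * cmod (F (Complex s y))"
      by (simp add: B_def mult_ac)
  qed
  also have "\<dots> = B * integral {-R..R} (\<lambda>s. cmod (F (Complex s y)))" by simp
  also have "\<dots> \<le> B * I" using I B0 by (rule mult_left_mono)
  finally show ?thesis by (simp add: B_def)
qed

end

lemma has_contour_integral_horizontal_iff:
  fixes a b y :: real
  assumes "a < b"
  shows "(f has_contour_integral I) (linepath (Complex a y) (Complex b y)) \<longleftrightarrow>
           ((\<lambda>s. f (Complex s y)) has_integral I) {a..b}"
proof -
  have l: "linepath (Complex a y) (Complex b y) x = linepath (of_real a) (of_real b) x + Complex 0 y" for x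
    by (simp add: linepath_def complex_eq_iff algebra_simps)
  have d: "Complex b y - Complex a y = of_real b - of_real a" by (simp add: complex_eq_iff)
  have "(f has_contour_integral I) (linepath (Complex a y) (Complex b y)) \<longleftrightarrow>
      ((\<lambda>w. f (w + Complex 0 y)) has_contour_integral I) (linepath (of_real a) (of_real b))"
    unfolding has_contour_integral_linepath l d ..
  also have "\<dots> \<longleftrightarrow> ((\<lambda>s. f (of_real s + Complex 0 y)) has_integral I) {a..b}"
    using assms has_contour_integral_linepath_Reals_iff[of "of_real a" "of_real b"] by simp
  also have "(\<lambda>s. f (of_real s + Complex 0 y)) = (\<lambda>s. f (Complex s y))"
    by (simp add: Complex_eq)
  finally show ?thesis .
qed

lemma sinc_indefinite_error_finite:
  fixes F :: "complex \<Rightarrow> complex" and h e d a x c B0 I :: real and m :: nat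
  defines "R \<equiv> (real m + 1/2) * h"
  assumes h: "0 < h" and e: "0 < e" "e < d" and F: "F holomorphic_on strip d"
    and B0: "\<And>z. \<bar>Im z\<bar> \<le> e \<Longrightarrow> cmod (F z) \<le> B0"
    and I: "\<And>y. \<bar>y\<bar> = e \<Longrightarrow> integral {-R..R} (\<lambda>s. cmod (F (Complex s y))) \<le> I"
    and ax: "a \<le> x" and a: "cos (pi * a / h) = 0"
    and c: "\<bar>a\<bar> \<le> c" "\<bar>x\<bar> \<le> c" "c < R"
  shows "cmod (integral {a..x} (\<lambda>t. F (of_real t))
            - (\<Sum>k=-int m..int m. F (of_real (real_of_int k * h)) * of_real (Jfun k h x - Jfun k h a)))
          \<le> h / e * (1 + 1 / pi) / sinh (pi * e / h) * I / pi + 2 * e * B0 / (R - c) / pi * (x - a)"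
proof -
  define E where "E = (\<lambda>t. F (of_real t)
     - (\<Sum>k=-int m..int m. F (of_real (real_of_int k * h)) * of_real (sinc (pi * (t / h - real_of_int k)))))"
  define P where "P = (\<lambda>y t. integral {-R..R} (\<lambda>s. line_kernel F h y s t))"
  \<comment> \<open>Contribution of the vertical sides alone. The upper side is traversed from right
    to left, hence the sign of \<open>P e t\<close>.\<close>
  define D where "D = (\<lambda>t. 2 * of_real pi * \<i> * E t - (P (-e) t - P e t))"
  have B0n: "0 \<le> B0" using B0[of 0] e by (auto intro: order_trans[OF norm_ge_zero])
  have Fc: "continuous_on {a..x} (\<lambda>t. F (of_real t))"
    by (rule continuous_on_compose2[OF holomorphic_on_imp_continuous_on[OF F]])
      (use e in \<open>auto simp: strip_def intro!: continuous_intros\<close>)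
  have R0: "0 < R" using h by (simp add: R_def)
  have Ei: "(E has_integral (integral {a..x} (\<lambda>t. F (of_real t))
            - (\<Sum>k=-int m..int m. F (of_real (real_of_int k * h)) * of_real (Jfun k h x - Jfun k h a)))) {a..x}"
    unfolding E_def
    by (intro has_integral_diff has_integral_sum has_integral_mult_right has_integral_of_real
        integrable_integral integrable_continuous_interval Fc sinc_has_integral_Jfun) (use h ax in auto)
  have Pc: "continuous_on {a..x} (P (-e))" "continuous_on {a..x} (P e)"
    unfolding P_def using continuous_on_integral_line_kernel[OF h _ _ F] e by auto
  have Pi: "P (-e) integrable_on {a..x}" "P e integrable_on {a..x}"
    using Pc by (auto intro: integrable_continuous_interval)
  have Di: "(D has_integral (2 * of_real pi * \<i> * integral {a..x} E
      - (integral {a..x} (P (-e)) - integral {a..x} (P e)))) {a..x}"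
    unfolding D_def using Ei Pi
    by (intro has_integral_diff has_integral_mult_right integrable_integral) auto
  \<comment> \<open>When \<open>t\<close> is a node, two poles merge and the contour formula does
    not apply. These finitely many points do not affect the integral of \<open>D\<close>.\<close>
  define Z where "Z = {t\<in>{a..x}. \<exists>k::int. t = real_of_int k * h}"
  have "finite Z"
  proof (rule finite_subset)
    show "Z \<subseteq> (\<lambda>k. real_of_int k * h) ` {-int m..int m}"
    proof
      fix t assume "t \<in> Z"
      then obtain k :: int where k: "t = real_of_int k * h" and t: "t \<in> {a..x}" by (auto simp: Z_def)
      have "\<bar>real_of_int k\<bar> * h < (real m + 1/2) * h"
      proof -
        have "\<bar>t\<bar> < R" using c t by auto
        then show ?thesis using h by (simp add: k abs_mult R_def)
      qed
      then have "\<bar>real_of_int k\<bar> < real m + 1/2" using h by simp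
      then have "k \<in> {-int m..int m}" by auto
      with k show "t \<in> (\<lambda>k. real_of_int k * h) ` {-int m..int m}" by blast
    qed
  qed simp
  have Dbound: "cmod (D t) \<le> 2 * (B0 / (R - c) * (2 * e))" if t: "t \<in> {a..x} - Z" for t
  proof -
    define f where "f = (\<lambda>z. F z / ((z - of_real t) * sin (of_real pi * z / of_real h)))"
    define s where "s = complex_of_real (sin (pi * t / h))"
    have tc: "\<bar>t\<bar> \<le> c" using t c by auto
    have tk: "t \<noteq> real_of_int k * h" for k :: int using t by (auto simp: Z_def)
    have vert: "R - c \<le> cmod (z - of_real t) \<and> 1 \<le> cmod (sin (of_real pi * z / of_real h))"
      if z: "\<bar>Re z\<bar> = R" for z
    proof
      show "R - c \<le> cmod (z - of_real t)"
        using abs_Re_le_cmod[of "z - of_real t"] z tc by simp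
      have "(sin (pi * Re z / h))\<^sup>2 = (sin (pi * (real m + 1/2)))\<^sup>2"
      proof -
        have "pi * Re z / h = pi * (real m + 1/2) \<or> pi * Re z / h = - (pi * (real m + 1/2))"
        proof -
          have "Re z = (real m + 1/2) * h \<or> Re z = - ((real m + 1/2) * h)"
            using z unfolding R_def by linarith
          then have "Re z / h = real m + 1/2 \<or> Re z / h = - (real m + 1/2)" using h by auto
          then show ?thesis by (metis minus_mult_right times_divide_eq_right)
        qed
        then show ?thesis by (metis power2_minus sin_minus)
      qed
      then show "1 \<le> cmod (sin (of_real pi * z / of_real h))"
        by (intro cmod_sin_ge_one) (simp add: sin_half_integer_sq)
    qed
    have nz: "z - of_real t \<noteq> 0 \<and> sin (of_real pi * z / of_real h) \<noteq> 0"
      if "\<bar>Re z\<bar> = R \<or> \<bar>Im z\<bar> = e" for z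
      using that
    proof
      assume "\<bar>Re z\<bar> = R"
      from vert[OF this] c(3) show ?thesis by auto
    next
      assume "\<bar>Im z\<bar> = e"
      then show ?thesis using line_ne[OF h, of "Im z" d F "Re z"] e F by auto
    qed
    have cont: "continuous_on (closed_segment p q) f"
      if "closed_segment p q \<subseteq> {z. (\<bar>Re z\<bar> = R \<or> \<bar>Im z\<bar> = e) \<and> \<bar>Im z\<bar> \<le> e}" for p q
      unfolding f_def using that nz h e
      by (intro continuous_intros continuous_on_subset[OF holomorphic_on_imp_continuous_on[OF F]])
        (auto simp: strip_def)
    define a1 a2 a3 a4 where "a1 = Complex (-R) (-e)" and "a2 = Complex R (-e)"
      and "a3 = Complex R e" and "a4 = Complex (-R) e"
    have seg: "closed_segment a1 a2 \<subseteq> {z. Im z = -e}" "closed_segment a2 a3 \<subseteq> {z. Re z = R \<and> \<bar>Im z\<bar> \<le> e}"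
      "closed_segment a3 a4 \<subseteq> {z. Im z = e}" "closed_segment a4 a1 \<subseteq> {z. Re z = -R \<and> \<bar>Im z\<bar> \<le> e}"
      using e R0 unfolding a1_def a2_def a3_def a4_def
      by (auto simp: closed_segment_same_Re closed_segment_same_Im closed_segment_eq_real_ivl)
    have ci: "f contour_integrable_on linepath a1 a2" "f contour_integrable_on linepath a2 a3"
      "f contour_integrable_on linepath a3 a4" "f contour_integrable_on linepath a4 a1"
      using seg e R0 by (auto intro!: contour_integrable_continuous_linepath cont)
    have rect: "contour_integral (rectpath a1 a3) f = contour_integral (linepath a1 a2) f +
       contour_integral (linepath a2 a3) f + contour_integral (linepath a3 a4) f + contour_integral (linepath a4 a1) f"
    proof -
      have "rectpath a1 a3 = linepath a1 a2 +++ linepath a2 a3 +++ linepath a3 a4 +++ linepath a4 a1"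
        by (simp add: rectpath_def a1_def a2_def a3_def a4_def Let_def)
      then show ?thesis using ci by simp
    qed
    have hor: "s * contour_integral (linepath (Complex (-R) y) (Complex R y)) f = P y t"
      if "f contour_integrable_on linepath (Complex (-R) y) (Complex R y)" for y
    proof -
      have "((\<lambda>u. f (Complex u y)) has_integral contour_integral (linepath (Complex (-R) y) (Complex R y)) f) {-R..R}"
        using has_contour_integral_integral[OF that] R0 by (subst (asm) has_contour_integral_horizontal_iff) auto
      from has_integral_mult_right[OF this, of s]
      have "s * contour_integral (linepath (Complex (-R) y) (Complex R y)) f = integral {-R..R} (\<lambda>u. s * f (Complex u y))"
        by (rule integral_unique[symmetric])
      also have "(\<lambda>u. s * f (Complex u y)) = (\<lambda>u. line_kernel F h y u t)"
        by (simp add: f_def line_kernel_def s_def mult_ac)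
      finally show ?thesis by (simp add: P_def)
    qed
    have c34: "contour_integral (linepath a3 a4) f = - contour_integral (linepath a4 a3) f"
      by (rule contour_integral_reverse_linepath, rule cont) (use seg(3) e in auto)
    have c43: "s * contour_integral (linepath a4 a3) f = P e t"
      unfolding a4_def a3_def
      by (rule hor, fold a4_def a3_def) 
        (use seg(3) e in \<open>auto intro!: contour_integrable_continuous_linepath cont simp: closed_segment_commute[of a4]\<close>)
    have c12: "s * contour_integral (linepath a1 a2) f = P (-e) t"
      unfolding a1_def a2_def by (rule hor, fold a1_def a2_def, rule ci)
    have res: "s * contour_integral (rectpath a1 a3) f = 2 * of_real pi * \<i> * E t"
      unfolding s_def f_def E_def a1_def a3_def R_def
      by (rule sinc_interpolation_contour[OF h e F _ tk]) (use tc c(3) R_def in auto)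
    have Dt: "D t = s * (contour_integral (linepath a2 a3) f + contour_integral (linepath a4 a1) f)"
      unfolding D_def res[symmetric] rect c34 c12[symmetric] c43[symmetric] by (simp add: ring_distribs)
    have vb: "cmod (f z) \<le> B0 / (R - c)" if "\<bar>Re z\<bar> = R" "\<bar>Im z\<bar> \<le> e" for z
    proof -
      have "cmod (f z) = cmod (F z) / (cmod (z - of_real t) * cmod (sin (of_real pi * z / of_real h)))"
        by (simp add: f_def norm_divide norm_mult)
      also have "\<dots> \<le> B0 / ((R - c) * 1)"
        using vert[OF that(1)] c(3) B0[OF that(2)] B0n
        by (intro frac_le mult_mono) auto
      finally show ?thesis by simp
    qed
    have v1: "cmod (contour_integral (linepath a2 a3) f) \<le> B0 / (R - c) * cmod (a3 - a2)"
      by (rule contour_integral_bound_linepath[OF ci(2)]) (use seg(2) vb B0n c(3) R0 in auto)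
    have v2: "cmod (contour_integral (linepath a4 a1) f) \<le> B0 / (R - c) * cmod (a1 - a4)"
      by (rule contour_integral_bound_linepath[OF ci(4)]) (use seg(4) vb B0n c(3) R0 in auto)
    have "a3 - a2 = of_real (2 * e) * \<i>" "a1 - a4 = of_real (- 2 * e) * \<i>"
      by (auto simp: a1_def a2_def a3_def a4_def complex_eq_iff)
    then have len: "cmod (a3 - a2) = 2 * e" "cmod (a1 - a4) = 2 * e"
      using e by (simp_all add: norm_mult)
    have "cmod (D t) = cmod s * cmod (contour_integral (linepath a2 a3) f + contour_integral (linepath a4 a1) f)"
      unfolding Dt norm_mult ..
    also have "\<dots> \<le> 1 * (B0 / (R - c) * (2 * e) + B0 / (R - c) * (2 * e))"
      using v1 v2 unfolding len
      by (intro mult_mono norm_triangle_le add_mono) (auto simp: s_def)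
    finally show ?thesis by simp
  qed
  have nD: "cmod (2 * of_real pi * \<i> * integral {a..x} E
      - (integral {a..x} (P (-e)) - integral {a..x} (P e))) \<le> 2 * (B0 / (R - c) * (2 * e)) * (x - a)"
  proof -
    have "0 \<le> 2 * (B0 / (R - c) * (2 * e))" using B0n c(3) e by simp
    from has_integral_bound_spike_finite[OF this \<open>finite Z\<close>, of D _ a x, unfolded box_real, OF Di Dbound]
    show ?thesis using ax by (simp add: content_real)
  qed
  define W where "W = h / e * (1 + 1 / pi) / sinh (pi * e / h) * I"
  have nP: "cmod (integral {a..x} (P y)) \<le> W" if "\<bar>y\<bar> = e" for y
    using norm_integral_line_kernel_le[OF h _ _ F I[OF that] ax a] that e
    by (auto simp: P_def W_def)
  have "2 * pi * cmod (integral {a..x} E) = cmod (2 * of_real pi * \<i> * integral {a..x} E)"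
    by (simp add: norm_mult)
  also have "\<dots> \<le> 2 * (B0 / (R - c) * (2 * e)) * (x - a) + (W + W)"
  proof -
    have "cmod u \<le> r + (w + w)" if "cmod (u - (p - q)) \<le> r" "cmod p \<le> w" "cmod q \<le> w" for u p q r w
    proof -
      have "cmod u \<le> cmod (u - (p - q)) + cmod (p - q)"
        using norm_triangle_ineq[of "u - (p - q)" "p - q"] by simp
      then show ?thesis using that norm_triangle_ineq4[of p q] by linarith
    qed
    from this[OF nD nP nP] show ?thesis using e by simp
  qed
  finally have "cmod (integral {a..x} E) \<le> (2 * (B0 / (R - c) * (2 * e)) * (x - a) + (W + W)) / (2 * pi)"
    by (simp add: field_simps)
  also have "\<dots> = W / pi + 2 * e * B0 / (R - c) / pi * (x - a)"
  proof -
    have "(2 * (r * (2 * e)) * l + (W + W)) / (2 * pi) = W / pi + 2 * e * r / pi * l" for r l :: real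
      by (simp add: field_simps)
    from this[of "B0 / (R - c)" "x - a"] show ?thesis by simp
  qed
  finally show ?thesis using integral_unique[OF Ei] by (simp add: W_def)
qed

subsection \<open>The double-exponential transformation\<close>

lemma connected_strip: "connected (strip d)"
proof -
  have "strip d = {z. - d < Im z} \<inter> {z. Im z < d}" by (auto simp: strip_def)
  then have "convex (strip d)"
    by (simp add: convex_Int convex_halfspace_Im_lt convex_halfspace_Im_gt)
  then show ?thesis by (rule convex_connected)
qed

lemma sinh_of_real: "sinh (complex_of_real x) = of_real (sinh x)"
  and cosh_of_real: "cosh (complex_of_real x) = of_real (cosh x)"
  unfolding sinh_field_def cosh_field_def
  by (simp_all only: exp_of_real of_real_minus[symmetric] of_real_diff of_real_add of_real_divide of_real_numeral)

lemma exp_sinh_of_real: "exp (of_real pi * sinh (complex_of_real x)) = of_real (exp (pi * sinh x))"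
  by (simp add: sinh_of_real exp_of_real flip: of_real_mult)

lemma psi_has_derivative:
  "(psi has_real_derivative (pi * cosh x * (exp (pi * sinh x) / (1 + exp (pi * sinh x))))) (at x)"
proof -
  have "0 < 1 + exp (pi * sinh x)" by (simp add: add_pos_pos)
  then have "((\<lambda>t. ln (1 + exp (pi * sinh t))) has_real_derivative
     (pi * cosh x * (exp (pi * sinh x) / (1 + exp (pi * sinh x))))) (at x)"
    by (auto intro!: derivative_eq_intros simp: divide_inverse)
  then show ?thesis unfolding psi_def[abs_def] .
qed

lemma psi_pos: "0 < psi x"
  unfolding psi_def by (rule ln_gt_zero) simp

lemma psi_psi_inv: "0 < tau \<Longrightarrow> psi (psi_inv tau) = tau"
  by (simp add: psi_def psi_inv_def)

lemma psi_mono: "x \<le> y \<Longrightarrow> psi x \<le> psi y"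
  by (simp add: psi_def add_pos_pos)

lemma psi_tendsto_0: "(psi \<longlongrightarrow> 0) at_bot"
proof -
  have "filterlim (\<lambda>t::real. pi * sinh t) at_bot at_bot"
    by (rule filterlim_tendsto_pos_mult_at_bot[OF tendsto_const _ sinh_real_at_bot]) simp
  then have "((\<lambda>t. exp (pi * sinh t)) \<longlongrightarrow> 0) at_bot"
    by (rule filterlim_compose[OF exp_at_bot])
  then have "((\<lambda>t. ln (1 + exp (pi * sinh t))) \<longlongrightarrow> ln (1 + 0)) at_bot"
    by (intro tendsto_intros) auto
  then show ?thesis unfolding psi_def[abs_def] by simp
qed

lemma one_plus_exp_powr_le:
  fixes u :: real
  assumes "0 < g"
  shows "(1 + exp u) powr (- g) \<le> exp (- (g * u))" "(1 + exp u) powr (- g) \<le> 1"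
proof -
  have "(1 + exp u) powr (- g) \<le> exp u powr (- g)" using assms by (intro powr_mono2') auto
  then show "(1 + exp u) powr (- g) \<le> exp (- (g * u))" by (simp add: powr_def)
  have "(1 + exp u) powr (- g) \<le> 1 powr (- g)" using assms by (intro powr_mono2') auto
  then show "(1 + exp u) powr (- g) \<le> 1" by simp
qed

text \<open>The principal logarithm of 1 + exp (pi sinh z) jumps in every strip: 1 + exp w is
  negative for Im w = pi, Re w > 0, and such values w = pi sinh z occur for small Im z and large Re
  z. So \<open>psi_c\<close> is described as the holomorphic branch fixed by its value ln 2 at 0.
  The point -1 is excluded in the bound because division by zero would make its right side 0 there
  and force f to vanish.\<close>

locale double_exponential =
  fixes d K alpha beta :: real and psi_c f :: "complex \<Rightarrow> complex"
  assumes d_pos: "0 < d" and d_lt: "d < pi / 2"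
    and psi_c_holo: "psi_c holomorphic_on strip d"
    and psi_c_exp: "\<And>z. z \<in> strip d \<Longrightarrow> exp (psi_c z) = 1 + exp (of_real pi * sinh z)"
    and psi_c_0: "psi_c 0 = of_real (ln 2)"
    and f_analytic: "f analytic_on (psi_c ` strip d)"
    and K_pos: "0 < K" and beta_pos: "0 < beta" and alpha_pos: "0 < alpha" and alpha_le: "alpha \<le> 1"
    and f_bound: "\<And>z. z \<in> psi_c ` strip d \<Longrightarrow> z \<noteq> -1 \<Longrightarrow>
        cmod (f z) \<le> K * cmod ((z / (1 + z)) powr (of_real (alpha - 1)) * exp (- of_real beta * z))"
begin

definition cd :: real where "cd = cos (pi / 2 * sin d)"
definition cc :: real where "cc = 1 + 1 / cd"
definition ct :: real where "ct = (1 + ln (1 + cc)) / ln (1 + cc) * cc"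
definition F :: "complex \<Rightarrow> complex" where "F z = f (psi_c z) * deriv psi_c z"
definition Q :: "complex \<Rightarrow> complex"
  where "Q z = exp (of_real pi * sinh z) / (1 + exp (of_real pi * sinh z))"

lemma one_plus_exp_ne: "z \<in> strip d \<Longrightarrow> 1 + exp (of_real pi * sinh z) \<noteq> 0"
  using psi_c_exp by (metis exp_not_eq_zero)

lemma Q_ne: "z \<in> strip d \<Longrightarrow> Q z \<noteq> 0"
  using one_plus_exp_ne by (simp add: Q_def)

lemma real_in_strip: "of_real x \<in> strip d"
  using d_pos by (simp add: strip_def)

text \<open>Differentiating both sides of the identity for exp (psi_c z) avoids any choice of
  branch.\<close>

lemma psi_c_has_derivative:
  assumes "z \<in> strip d"
  shows "(psi_c has_field_derivative (of_real pi * cosh z * Q z)) (at z)"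
proof -
  have der: "(psi_c has_field_derivative deriv psi_c z) (at z)"
    using psi_c_holo open_strip assms by (rule holomorphic_derivI)
  then have "((\<lambda>z. exp (psi_c z)) has_field_derivative exp (psi_c z) * deriv psi_c z) (at z)"
    by (auto intro!: derivative_eq_intros)
  moreover have "((\<lambda>z. exp (psi_c z)) has_field_derivative exp (of_real pi * sinh z) * (of_real pi * cosh z)) (at z)"
  proof (rule has_field_derivative_transform_within_open[OF _ open_strip assms])
    show "((\<lambda>z. 1 + exp (of_real pi * sinh z)) has_field_derivative exp (of_real pi * sinh z) * (of_real pi * cosh z)) (at z)"
      by (auto intro!: derivative_eq_intros)
  qed (simp add: psi_c_exp)
  ultimately have "exp (psi_c z) * deriv psi_c z = exp (of_real pi * sinh z) * (of_real pi * cosh z)"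
    by (rule DERIV_unique)
  then have "deriv psi_c z = of_real pi * cosh z * Q z"
    using one_plus_exp_ne[OF assms] by (simp add: psi_c_exp[OF assms] Q_def field_simps)
  with der show ?thesis by simp
qed

lemma deriv_psi_c: "z \<in> strip d \<Longrightarrow> deriv psi_c z = of_real pi * cosh z * Q z"
  by (rule DERIV_imp_deriv[OF psi_c_has_derivative])

lemma Q_of_real: "Q (of_real x) = of_real (exp (pi * sinh x) / (1 + exp (pi * sinh x)))"
  by (simp add: Q_def exp_sinh_of_real)

text \<open>Both functions have the same derivative along the real axis, and the normalization at 0
  makes them agree there.\<close>

lemma psi_c_of_real: "psi_c (of_real x) = of_real (psi x)"
proof -
  define g where "g = (\<lambda>x. psi_c (of_real x) - of_real (psi x))"
  have "(g has_vector_derivative 0) (at x within UNIV)" for x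
  proof -
    have "((\<lambda>x. psi_c (of_real x)) has_vector_derivative (of_real pi * cosh (of_real x) * Q (of_real x))) (at x)"
      by (rule has_vector_derivative_real_field[OF psi_c_has_derivative[OF real_in_strip]])
    moreover have "((\<lambda>x. complex_of_real (psi x)) has_vector_derivative
        of_real (pi * cosh x * (exp (pi * sinh x) / (1 + exp (pi * sinh x))))) (at x)"
      by (rule has_vector_derivative_of_real)
        (use psi_has_derivative in \<open>simp add: has_real_derivative_iff_has_vector_derivative[symmetric]\<close>)
    ultimately have "(g has_vector_derivative (of_real pi * cosh (of_real x) * Q (of_real x)
        - of_real (pi * cosh x * (exp (pi * sinh x) / (1 + exp (pi * sinh x)))))) (at x)"
      unfolding g_def by (rule has_vector_derivative_diff)
    then show ?thesis by (simp add: Q_of_real cosh_of_real)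
  qed
  then obtain c where "\<And>x. g x = c"
    using has_vector_derivative_zero_constant[of UNIV g] by auto
  then have "g x = g 0" by simp
  also have "g 0 = 0" using psi_c_0 by (simp add: g_def psi_def)
  finally show ?thesis by (simp add: g_def)
qed

lemma F_of_real: "F (of_real x) = f (of_real (psi x)) * of_real (deriv psi x)"
  using DERIV_imp_deriv[OF psi_has_derivative, of x]
  by (simp add: F_def psi_c_of_real deriv_psi_c[OF real_in_strip] Q_of_real cosh_of_real)

lemma F_holomorphic: "F holomorphic_on strip d"
proof -
  have "f \<circ> psi_c holomorphic_on strip d"
    using psi_c_holo analytic_imp_holomorphic[OF f_analytic] by (rule holomorphic_on_compose)
  then show ?thesis
    unfolding F_def[abs_def] o_def
    by (intro holomorphic_intros holomorphic_deriv psi_c_holo open_strip)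
qed

text \<open>The exponent is real, so the power may be taken of the modulus, and 1 - alpha >= 0
  allows an upper bound for (1 + w) / w. Bounding it by A / |Q| replaces the logarithm w by the
  explicit function \<open>Q\<close>. \<open>A\<close> is \<open>ct\<close> on the strip and 3/2 on
  the real axis.\<close>

lemma f_psi_c_le_aux:
  assumes z: "z \<in> strip d" "psi_c z \<noteq> -1" and A: "cmod ((1 + psi_c z) / psi_c z * Q z) \<le> A"
  shows "cmod (f (psi_c z)) \<le> K * ((A / cmod (Q z)) powr (1 - alpha) *
           cmod (1 + exp (of_real pi * sinh z)) powr (- beta))"
proof -
  have w0: "psi_c z \<noteq> 0" using psi_c_exp[OF z(1)] by auto
  have w1: "1 + psi_c z \<noteq> 0" using z(2) by (metis add.commute add_eq_0_iff)
  have Qpos: "0 < cmod (Q z)" using Q_ne[OF z(1)] by simp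
  have "cmod ((psi_c z / (1 + psi_c z)) powr (of_real (alpha - 1)))
      = cmod (psi_c z / (1 + psi_c z)) powr (alpha - 1)"
    by (subst norm_powr_real_powr') auto
  also have "\<dots> = cmod ((1 + psi_c z) / psi_c z) powr (1 - alpha)"
  proof -
    have "cmod ((1 + psi_c z) / psi_c z) = inverse (cmod (psi_c z / (1 + psi_c z)))"
      by (simp add: norm_divide)
    then show ?thesis using w0 w1 by (simp add: powr_minus[symmetric] inverse_powr)
  qed
  also have "\<dots> \<le> (A / cmod (Q z)) powr (1 - alpha)"
  proof (intro powr_mono2)
    show "cmod ((1 + psi_c z) / psi_c z) \<le> A / cmod (Q z)"
      using A Qpos unfolding norm_mult by (simp add: pos_le_divide_eq)
  qed (use alpha_le in auto)
  finally have 1: "cmod ((psi_c z / (1 + psi_c z)) powr (of_real (alpha - 1))) \<le> (A / cmod (Q z)) powr (1 - alpha)" .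
  have 2: "cmod (exp (- of_real beta * psi_c z)) = cmod (1 + exp (of_real pi * sinh z)) powr (- beta)"
    using psi_c_exp[OF z(1), symmetric] by (simp add: powr_def)
  have "cmod (f (psi_c z)) \<le> K * (cmod ((psi_c z / (1 + psi_c z)) powr (of_real (alpha - 1))) * cmod (exp (- of_real beta * psi_c z)))"
    using f_bound[of "psi_c z"] z by (simp add: norm_mult)
  also have "\<dots> \<le> K * ((A / cmod (Q z)) powr (1 - alpha) * cmod (1 + exp (of_real pi * sinh z)) powr (- beta))"
    unfolding 2 using 1 K_pos by (intro mult_left_mono mult_right_mono) auto
  finally show ?thesis .
qed

text \<open>A point where \<open>psi_c z = -1\<close>, at which the hypothesis on \<open>f\<close> is void, is isolated, so the
  bound extends to it by continuity.\<close>
lemma f_psi_c_le: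
  assumes z: "z \<in> strip d" and A: "\<And>z. z \<in> strip d \<Longrightarrow> cmod ((1 + psi_c z) / psi_c z * Q z) \<le> A"
  shows "cmod (f (psi_c z)) \<le> K * ((A / cmod (Q z)) powr (1 - alpha) *
           cmod (1 + exp (of_real pi * sinh z)) powr (- beta))"
proof -
  define G where "G = (\<lambda>z. K * ((A / cmod (Q z)) powr (1 - alpha) *
           cmod (1 + exp (of_real pi * sinh z)) powr (- beta)))"
  have A0: "0 < A"
  proof -
    have "(0::real) < ln 2" "(0::real) < 1 + ln 2" by (auto simp: add_pos_pos)
    then have "psi_c 0 \<noteq> 0" "1 + psi_c 0 \<noteq> 0"
      using psi_c_0 by (auto simp: complex_eq_iff)
    then have "0 < cmod ((1 + psi_c 0) / psi_c 0 * Q 0)"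
      using Q_ne[of 0] real_in_strip[of 0] by simp
    also have "\<dots> \<le> A" using A[of 0] real_in_strip[of 0] by simp
    finally show ?thesis .
  qed
  have ev: "\<forall>\<^sub>F w in at z. psi_c w + 1 \<noteq> 0 \<and> w \<in> strip d"
  proof (rule non_zero_neighbour_alt[where \<beta> = 0])
    show "(\<lambda>w. psi_c w + 1) holomorphic_on strip d" by (intro holomorphic_intros psi_c_holo)
    have "(0::real) < ln 2 + 1" by (simp add: add_pos_pos)
    then show "psi_c 0 + 1 \<noteq> 0" using psi_c_0
      by (metis less_irrefl of_real_1 of_real_add of_real_eq_0_iff)
  qed (use z open_strip connected_strip real_in_strip[of 0] in auto)
  have iso: "isCont psi_c z" using psi_c_has_derivative[OF z] by (rule DERIV_isCont)
  have "isCont (f \<circ> psi_c) z"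
  proof (rule holomorphic_on_imp_continuous_on[of _ "strip d", THEN continuous_on_interior])
    show "f \<circ> psi_c holomorphic_on strip d"
      using psi_c_holo analytic_imp_holomorphic[OF f_analytic] by (rule holomorphic_on_compose)
    show "z \<in> interior (strip d)" using z open_strip by (simp add: interior_open)
  qed
  then have lim1: "((\<lambda>w. cmod (f (psi_c w))) \<longlongrightarrow> cmod (f (psi_c z))) (at z)"
    by (intro tendsto_norm) (simp add: isCont_def o_def)
  have "isCont G z"
    unfolding G_def Q_def using one_plus_exp_ne[OF z] A0
    by (intro continuous_intros) auto
  then have lim2: "(G \<longlongrightarrow> G z) (at z)" by (simp add: isCont_def)
  have "cmod (f (psi_c z)) \<le> G z"
  proof (rule tendsto_le[OF _ lim2 lim1])
    show "\<forall>\<^sub>F w in at z. cmod (f (psi_c w)) \<le> G w"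
      using ev
    proof eventually_elim
      case (elim w)
      then have "psi_c w \<noteq> -1" by auto
      then show ?case unfolding G_def using elim A by (intro f_psi_c_le_aux) auto
    qed
  qed simp
  then show ?thesis by (simp add: G_def)
qed

lemma norm_F_eq:
  assumes "z \<in> strip d"
  shows "cmod (F z) = cmod (f (psi_c z)) * (pi * cmod (cosh z) * cmod (Q z))"
  using deriv_psi_c[OF assms] by (simp add: F_def norm_mult)

text \<open>The derivative of \<open>psi_c\<close> contributes a factor |Q|; with |Q|^(alpha - 1)
  from the bound on f it leaves |Q|^alpha, and 1 / Q = 1 + exp (- pi sinh z). This makes alpha and
  beta symmetric: they govern the decay to the left and to the right.\<close>

lemma norm_F_le_aux:
  assumes z: "z \<in> strip d" and A: "0 \<le> A"
    and le: "cmod (f (psi_c z)) \<le> K * ((A / cmod (Q z)) powr (1 - alpha) *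
           cmod (1 + exp (of_real pi * sinh z)) powr (- beta))"
    and u: "0 < u" "u \<le> cmod (1 + exp (of_real pi * sinh z))"
    and v: "0 < v" "v \<le> cmod (1 + exp (- (of_real pi * sinh z)))"
  shows "cmod (F z) \<le> K * A powr (1 - alpha) * (pi * cosh (Re z)) * (v powr (- alpha) * u powr (- beta))"
proof -
  have Qpos: "0 < cmod (Q z)" using Q_ne[OF z] by simp
  have Qv: "cmod (Q z) \<le> inverse v"
  proof -
    have "Q z = inverse (1 + exp (- (of_real pi * sinh z)))"
      using one_plus_exp_ne[OF z] by (simp add: Q_def exp_minus field_simps)
    then have "cmod (Q z) = inverse (cmod (1 + exp (- (of_real pi * sinh z))))"
      by (simp add: norm_inverse)
    with v show ?thesis by (simp add: le_imp_inverse_le)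
  qed
  have eq: "(A / cmod (Q z)) powr (1 - alpha) * cmod (Q z) = A powr (1 - alpha) * cmod (Q z) powr alpha"
  proof -
    have "cmod (Q z) powr (1 - alpha) * cmod (Q z) powr alpha = cmod (Q z)"
      using Qpos by (simp flip: powr_add)
    then show ?thesis using Qpos A by (simp add: powr_divide field_simps)
  qed
  have "cmod (F z) \<le> (K * ((A / cmod (Q z)) powr (1 - alpha) *
           cmod (1 + exp (of_real pi * sinh z)) powr (- beta))) * (pi * cosh (Re z) * cmod (Q z))"
    unfolding norm_F_eq[OF z] using le K_pos cmod_cosh_le[of z]
    by (intro mult_mono) auto
  also have "\<dots> = K * (pi * cosh (Re z)) * ((A / cmod (Q z)) powr (1 - alpha) * cmod (Q z)) *
       cmod (1 + exp (of_real pi * sinh z)) powr (- beta)" by simp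
  also have "\<dots> = K * A powr (1 - alpha) * (pi * cosh (Re z)) * (cmod (Q z) powr alpha *
       cmod (1 + exp (of_real pi * sinh z)) powr (- beta))"
    unfolding eq by simp
  also have "\<dots> \<le> K * A powr (1 - alpha) * (pi * cosh (Re z)) * (inverse v powr alpha * u powr (- beta))"
    using Qv u v K_pos alpha_pos beta_pos
    by (intro mult_left_mono mult_mono powr_mono2 powr_mono2') auto
  also have "inverse v powr alpha = v powr (- alpha)" using v by (simp add: powr_minus inverse_powr)
  finally show ?thesis .
qed

section \<open>Explicit bounds for \<open>F\<close> on the strip and on the real axis\<close>

lemma cd_pos: "0 < cd"
proof -
  have "sin d < 1" using sin_monotone_2pi[of d "pi/2"] d_pos d_lt by simp
  moreover have "0 < sin d" using d_pos d_lt by (intro sin_gt_zero) auto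
  ultimately have "pi / 2 * sin d < pi / 2 * 1" "0 < pi / 2 * sin d"
    by (intro mult_strict_left_mono mult_pos_pos; simp)+
  then show ?thesis unfolding cd_def by (intro cos_gt_zero_pi) linarith+
qed

lemma cd_le:
  assumes "\<bar>y\<bar> \<le> d"
  shows "cd \<le> cos (pi / 2 * sin y)"
proof -
  have "\<bar>sin y\<bar> = sin \<bar>y\<bar>" using assms d_lt sin_ge_zero[of "\<bar>y\<bar>"] by (cases "0 \<le> y") auto
  moreover have "sin \<bar>y\<bar> \<le> sin d" using assms d_lt by (intro sin_monotone_2pi_le) auto
  ultimately have "\<bar>pi / 2 * sin y\<bar> \<le> pi / 2 * sin d" by (simp add: abs_mult)
  moreover have "pi / 2 * sin d \<le> pi / 2 * 1" by (intro mult_left_mono) auto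
  then have "pi / 2 * sin d \<le> pi" using pi_gt_zero by linarith
  ultimately have "cos (pi / 2 * sin d) \<le> cos \<bar>pi / 2 * sin y\<bar>"
    by (intro cos_monotone_0_pi_le) auto
  then show ?thesis by (simp only: cd_def cos_abs_real)
qed

lemma strip_bounds:
  assumes z: "z \<in> strip d"
  shows "(1 + exp (pi * (sinh (Re z) * cos (Im z)))) * cd \<le> cmod (1 + exp (of_real pi * sinh z))"
    and "(1 + exp (- (pi * (sinh (Re z) * cos (Im z))))) * cd \<le> cmod (1 + exp (- (of_real pi * sinh z)))"
proof -
  have z': "\<bar>Im z\<bar> < pi/2" "\<bar>Im z\<bar> \<le> d" using z d_lt by (auto simp: strip_def)
  have *: "(1 + exp (pi * (sinh (Re w) * cos (Im w)))) * cd \<le> cmod (1 + exp (of_real pi * sinh w))"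
    if "\<bar>Im w\<bar> < pi/2" "\<bar>Im w\<bar> \<le> d" for w
  proof (rule order_trans[OF _ cmod_one_plus_exp_sinh_ge[OF that(1)]])
    show "(1 + exp (pi * (sinh (Re w) * cos (Im w)))) * cd
        \<le> (1 + exp (pi * (sinh (Re w) * cos (Im w)))) * cos (pi/2 * sin (Im w))"
      using cd_le[OF that(2)] by (intro mult_left_mono) (auto simp: add_nonneg_nonneg)
  qed
  from *[OF z'] show "(1 + exp (pi * (sinh (Re z) * cos (Im z)))) * cd \<le> cmod (1 + exp (of_real pi * sinh z))" .
  \<comment> \<open>sinh is odd, so the second bound is the first one at - z.\<close>
  from *[of "- z"] z' show "(1 + exp (- (pi * (sinh (Re z) * cos (Im z))))) * cd \<le> cmod (1 + exp (- (of_real pi * sinh z)))"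
    by simp
qed

lemma cc_gt: "1 < cc"
  using cd_pos by (simp add: cc_def)

lemma ct_pos: "0 < ct"
  using cc_gt by (simp add: ct_def add_pos_pos)

lemma log_ratio_le_ct:
  assumes z: "z \<in> strip d"
  shows "cmod ((1 + psi_c z) / psi_c z * Q z) \<le> ct"
proof -
  have "cmod (Q z) \<le> cc"
  proof -
    have "Q z = inverse (1 + exp (- (of_real pi * sinh z)))"
      using one_plus_exp_ne[OF z] by (simp add: Q_def exp_minus field_simps)
    then have "cmod (Q z) = inverse (cmod (1 + exp (- (of_real pi * sinh z))))"
      by (simp add: norm_inverse)
    also have "\<dots> \<le> inverse cd"
    proof (rule le_imp_inverse_le[OF _ cd_pos])
      have "1 * cd \<le> (1 + exp (- (pi * (sinh (Re z) * cos (Im z))))) * cd"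
        using cd_pos by (intro mult_right_mono) auto
      with strip_bounds(2)[OF z] show "cd \<le> cmod (1 + exp (- (of_real pi * sinh z)))" by simp
    qed
    also have "\<dots> \<le> cc" by (simp add: cc_def inverse_eq_divide)
    finally show ?thesis .
  qed
  then show ?thesis
    unfolding ct_def Q_def using cmod_log_ratio_le[OF psi_c_exp[OF z] cc_gt] by simp
qed

text \<open>The part of the strip bound that does not depend on z; the power of \<open>cd\<close>
  collects what is lost in passing from the complex moduli of 1 + exp to real values.\<close>

definition FB :: real where "FB = K * ct powr (1 - alpha) / cd powr (alpha + beta)"

lemma FB_pos: "0 < FB"
  using K_pos ct_pos cd_pos by (simp add: FB_def)

lemma exp_products_le:
  fixes u :: real
  shows "(1 + exp (- u)) powr (- alpha) * (1 + exp u) powr (- beta) \<le> exp (- (beta * u))"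
  "(1 + exp (- u)) powr (- alpha) * (1 + exp u) powr (- beta) \<le> exp (alpha * u)"
proof -
  show "(1 + exp (- u)) powr (- alpha) * (1 + exp u) powr (- beta) \<le> exp (- (beta * u))"
    using mult_mono[OF one_plus_exp_powr_le(2)[OF alpha_pos, of "-u"] one_plus_exp_powr_le(1)[OF beta_pos, of u]] by simp
  show "(1 + exp (- u)) powr (- alpha) * (1 + exp u) powr (- beta) \<le> exp (alpha * u)"
    using mult_mono[OF one_plus_exp_powr_le(1)[OF alpha_pos, of "-u"] one_plus_exp_powr_le(2)[OF beta_pos, of u]] by simp
qed

text \<open>In each bound one of the two factors is kept and the other is estimated by 1; the first
  is of use on the right half of the strip, the second on the left half.\<close>

lemma norm_F_strip_le:
  assumes z: "z \<in> strip d"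
  shows "cmod (F z) \<le> FB * (pi * cosh (Re z)) * exp (- (pi * (beta * cos (Im z)) * sinh (Re z)))"
    and "cmod (F z) \<le> FB * (pi * cosh (Re z)) * exp (pi * (alpha * cos (Im z)) * sinh (Re z))"
proof -
  define w where "w = pi * (sinh (Re z) * cos (Im z))"
  have pos: "0 < (1 + exp w) * cd" "0 < (1 + exp (- w)) * cd"
    using cd_pos by (auto intro!: mult_pos_pos add_pos_pos)
  have "cmod (F z) \<le> K * ct powr (1 - alpha) * (pi * cosh (Re z)) *
     (((1 + exp (- w)) * cd) powr (- alpha) * ((1 + exp w) * cd) powr (- beta))"
    by (rule norm_F_le_aux[OF z _ f_psi_c_le[OF z log_ratio_le_ct]])
      (use pos strip_bounds[OF z] ct_pos in \<open>auto simp: w_def\<close>)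
  also have "((1 + exp (- w)) * cd) powr (- alpha) * ((1 + exp w) * cd) powr (- beta)
     = ((1 + exp (- w)) powr (- alpha) * (1 + exp w) powr (- beta)) / cd powr (alpha + beta)"
    by (simp add: powr_mult powr_minus powr_add divide_inverse)
  finally have *: "cmod (F z) \<le> FB * (pi * cosh (Re z)) * ((1 + exp (- w)) powr (- alpha) * (1 + exp w) powr (- beta))"
    by (simp add: FB_def)
  have "cmod (F z) \<le> FB * (pi * cosh (Re z)) * exp (- (beta * w))"
    by (rule order_trans[OF *]) (use exp_products_le FB_pos in \<open>auto intro!: mult_left_mono\<close>)
  then show "cmod (F z) \<le> FB * (pi * cosh (Re z)) * exp (- (pi * (beta * cos (Im z)) * sinh (Re z)))"
    by (simp add: w_def mult_ac)
  have "cmod (F z) \<le> FB * (pi * cosh (Re z)) * exp (alpha * w)"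
    by (rule order_trans[OF *]) (use exp_products_le FB_pos in \<open>auto intro!: mult_left_mono\<close>)
  then show "cmod (F z) \<le> FB * (pi * cosh (Re z)) * exp (pi * (alpha * cos (Im z)) * sinh (Re z))"
    by (simp add: w_def mult_ac)
qed

text \<open>On the real axis the moduli are exact, so no \<open>cd\<close> is lost, and the ratio
  bound is 3/2.\<close>

lemma norm_F_real_le:
  shows "cmod (F (of_real x)) \<le> K * (3/2) powr (1 - alpha) * (pi * cosh x * exp (- (pi * beta * sinh x)))"
    and "cmod (F (of_real x)) \<le> K * (3/2) powr (1 - alpha) * (pi * cosh x * exp (pi * alpha * sinh x))"
proof -
  define w where "w = pi * sinh x"
  have rat: "cmod ((1 + psi_c (of_real x)) / psi_c (of_real x) * Q (of_real x)) \<le> 3/2"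
  proof -
    define t where "t = psi x"
    have t0: "0 < t" by (simp add: t_def psi_pos)
    have et: "exp t = 1 + exp w" by (simp add: t_def psi_def w_def add_pos_pos)
    have "exp w / (1 + exp w) = 1 - exp (- t)"
    proof -
      have "exp w / (1 + exp w) = (exp t - 1) / exp t" by (simp add: et)
      also have "\<dots> = 1 - exp (- t)" by (simp add: diff_divide_distrib exp_minus inverse_eq_divide)
      finally show ?thesis .
    qed
    then have "(1 + psi_c (of_real x)) / psi_c (of_real x) * Q (of_real x) = of_real ((1 + t) / t * (1 - exp (- t)))"
      unfolding psi_c_of_real Q_of_real w_def[symmetric] t_def[symmetric] by simp
    then have "cmod ((1 + psi_c (of_real x)) / psi_c (of_real x) * Q (of_real x)) = \<bar>(1 + t) / t * (1 - exp (- t))\<bar>"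
      by (simp only: norm_of_real)
    also have "\<dots> = (1 + t) / t * (1 - exp (- t))" using t0 by simp
    also have "\<dots> \<le> 3/2" using t0 by (rule real_log_ratio_le)
    finally show ?thesis .
  qed
  have ne: "psi_c (of_real x) \<noteq> -1"
    using psi_pos[of x] by (auto simp: psi_c_of_real complex_eq_iff)
  have n1: "cmod (1 + exp (of_real pi * sinh (of_real x))) = 1 + exp w"
  proof -
    have "1 + exp (of_real pi * sinh (of_real x)) = complex_of_real (1 + exp w)"
      by (simp add: w_def exp_sinh_of_real)
    then show ?thesis by (simp only: norm_of_real) (simp add: add_pos_pos)
  qed
  have n2: "cmod (1 + exp (- (of_real pi * sinh (of_real x)))) = 1 + exp (- w)"
  proof -
    have "1 + exp (- (of_real pi * sinh (of_real x))) = complex_of_real (1 + exp (- w))"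
      by (simp only: exp_minus exp_sinh_of_real w_def of_real_add of_real_1 of_real_inverse)
    then show ?thesis by (simp only: norm_of_real) (simp add: add_pos_pos)
  qed
  have *: "cmod (F (of_real x)) \<le> K * (3/2) powr (1 - alpha) * (pi * cosh (Re (of_real x))) *
     ((1 + exp (- w)) powr (- alpha) * (1 + exp w) powr (- beta))"
    by (rule norm_F_le_aux[OF real_in_strip _ f_psi_c_le_aux[OF real_in_strip ne rat]])
      (auto simp: n1 n2 add_pos_pos)
  have "cmod (F (of_real x)) \<le> K * (3/2) powr (1 - alpha) * (pi * cosh (Re (of_real x))) * exp (- (beta * w))"
    by (rule order_trans[OF *]) (use exp_products_le K_pos in \<open>auto intro!: mult_left_mono\<close>)
  then show "cmod (F (of_real x)) \<le> K * (3/2) powr (1 - alpha) * (pi * cosh x * exp (- (pi * beta * sinh x)))"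
    by (simp add: w_def mult_ac)
  have "cmod (F (of_real x)) \<le> K * (3/2) powr (1 - alpha) * (pi * cosh (Re (of_real x))) * exp (alpha * w)"
    by (rule order_trans[OF *]) (use exp_products_le K_pos in \<open>auto intro!: mult_left_mono\<close>)
  then show "cmod (F (of_real x)) \<le> K * (3/2) powr (1 - alpha) * (pi * cosh x * exp (pi * alpha * sinh x))"
    by (simp add: w_def mult_ac)
qed

end

subsection \<open>Error bounds\<close>

lemma has_integral_cosh_exp_sinh:
  fixes a b g :: real
  assumes "a \<le> b" "g \<noteq> 0"
  shows "((\<lambda>s. pi * cosh s * exp (- (pi * g * sinh s))) has_integral
           ((exp (- (pi * g * sinh a)) - exp (- (pi * g * sinh b))) / g)) {a..b}"
proof -
  have "((\<lambda>s. pi * cosh s * exp (- (pi * g * sinh s))) has_integral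
           (- exp (- (pi * g * sinh b)) / g - - exp (- (pi * g * sinh a)) / g)) {a..b}"
  proof (rule fundamental_theorem_of_calculus[OF assms(1)])
    fix s
    have "((\<lambda>s. - exp (- (pi * g * sinh s)) / g) has_real_derivative
        pi * cosh s * exp (- (pi * g * sinh s))) (at s within {a..b})"
      using assms by (auto intro!: derivative_eq_intros)
    then show "((\<lambda>s. - exp (- (pi * g * sinh s)) / g) has_vector_derivative
        pi * cosh s * exp (- (pi * g * sinh s))) (at s within {a..b})"
      by (simp only: has_real_derivative_iff_has_vector_derivative)
  qed
  moreover have "- exp (- (pi * g * sinh b)) / g - - exp (- (pi * g * sinh a)) / g
      = (exp (- (pi * g * sinh a)) - exp (- (pi * g * sinh b))) / g"
    by (simp add: diff_divide_distrib)
  ultimately show ?thesis by simp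
qed

lemma cosh_le_one_plus_abs_sinh: "cosh x \<le> 1 + \<bar>sinh x\<bar>" for x :: real
proof (rule power2_le_imp_le)
  show "(cosh x)\<^sup>2 \<le> (1 + \<bar>sinh x\<bar>)\<^sup>2" by (simp add: cosh_square_eq power2_sum)
qed simp

text \<open>With r = 2 X / g, sinh (ln r) = (r - 1/r) / 2 yields pi g sinh y >= pi X - pi g^2 / (4
  X). Cutting at ln (2 X / alpha) on the left and ln (2 X / beta) on the right thus gives both tails
  the leading decay exp (- pi X).\<close>

lemma exp_minus_sinh_le:
  fixes g y X nu :: real
  assumes g: "0 < g" "g \<le> nu" and X: "0 < X" and y: "ln (2 * X / g) \<le> y"
  shows "exp (- (pi * g * sinh y)) \<le> exp (- (pi * X) + pi * nu\<^sup>2 / (4 * X))"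
proof -
  define l where "l = ln (2 * X / g)"
  have el: "exp l = 2 * X / g" using g X by (simp add: l_def)
  have "X / g - g / (4 * X) = (exp l - inverse (exp l)) / 2" unfolding el using g X by (simp add: field_simps)
  also have "\<dots> = sinh l" by (simp add: sinh_field_def exp_minus)
  also have "\<dots> \<le> sinh y" using y by (simp add: l_def)
  finally have "pi * g * (X / g - g / (4 * X)) \<le> pi * g * sinh y" using g by (intro mult_left_mono) auto
  moreover have "pi * g * (X / g - g / (4 * X)) = pi * X - pi * (g\<^sup>2 / (4 * X))"
    using g X by (simp add: right_diff_distrib power2_eq_square)
  moreover have "pi * (g\<^sup>2 / (4 * X)) \<le> pi * (nu\<^sup>2 / (4 * X))"
    using g X by (intro mult_left_mono divide_right_mono power_mono) auto
  ultimately show ?thesis by simp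
qed

context double_exponential
begin

definition mu :: real where "mu = min alpha beta"

lemma mu_pos: "0 < mu" and mu_le: "mu \<le> alpha" "mu \<le> beta"
  using alpha_pos beta_pos by (auto simp: mu_def)

lemma cos_d_pos: "0 < cos d"
  using d_pos d_lt by (intro cos_gt_zero) auto

lemma cos_d_le: "\<bar>y\<bar> \<le> d \<Longrightarrow> cos d \<le> cos y"
  using cos_monotone_0_pi_le[of "\<bar>y\<bar>" d] d_lt by simp

text \<open>The bounds for \<open>F\<close> have explicit primitives. Each half line contributes at
  most FB / g, with g = beta cos y on the right and g = alpha cos y on the left, and g >= mu cos d
  in both cases. Nothing depends on \<open>R\<close> or \<open>y\<close>, so the bound survives both
  limits.\<close>

lemma integral_norm_F_line_le:
  assumes y: "\<bar>y\<bar> < d" and R: "0 \<le> R"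
  shows "integral {-R..R} (\<lambda>s. cmod (F (Complex s y))) \<le> FB * (2 / (mu * cos d))"
proof -
  have cy: "cos d \<le> cos y" using y by (intro cos_d_le) auto
  have "continuous_on {-R..R} (\<lambda>s. F (Complex s y))"
    by (rule continuous_on_compose2[OF holomorphic_on_imp_continuous_on[OF F_holomorphic]])
      (use y in \<open>auto simp: strip_def Complex_eq intro!: continuous_intros\<close>)
  then have int: "(\<lambda>s. cmod (F (Complex s y))) integrable_on {-R..R}"
    by (intro integrable_continuous_interval continuous_intros)
  have z: "Complex s y \<in> strip d" for s using y by (simp add: strip_def)
  have le: "1 / (g * cos y) \<le> 1 / (mu * cos d)" if "mu \<le> g" for g
    using that mu_pos cos_d_pos cy by (intro divide_left_mono mult_mono mult_pos_pos) auto
  have right: "integral {0..R} (\<lambda>s. cmod (F (Complex s y))) \<le> FB * (1 / (mu * cos d))"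
  proof -
    define g where "g = beta * cos y"
    have g0: "0 < g" using beta_pos cy cos_d_pos by (simp add: g_def)
    have "((\<lambda>s. FB * (pi * cosh s * exp (- (pi * g * sinh s)))) has_integral
        (FB * ((exp (- (pi * g * sinh 0)) - exp (- (pi * g * sinh R))) / g))) {0..R}"
      using g0 R by (intro has_integral_mult_right has_integral_cosh_exp_sinh) auto
    moreover have "((\<lambda>s. cmod (F (Complex s y))) has_integral integral {0..R} (\<lambda>s. cmod (F (Complex s y)))) {0..R}"
      using integrable_subinterval_real[OF int, of 0 R] R by auto
    ultimately have "integral {0..R} (\<lambda>s. cmod (F (Complex s y)))
        \<le> FB * ((exp (- (pi * g * sinh 0)) - exp (- (pi * g * sinh R))) / g)"
      using norm_F_strip_le(1)[OF z] by (elim has_integral_le[rotated]) (auto simp: g_def mult_ac)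
    also have "\<dots> \<le> FB * (1 / g)"
      using FB_pos g0 by (intro mult_left_mono divide_right_mono) auto
    also have "\<dots> \<le> FB * (1 / (mu * cos d))"
      using FB_pos le[OF mu_le(2)] unfolding g_def by (intro mult_left_mono) auto
    finally show ?thesis .
  qed
  have left: "integral {-R..0} (\<lambda>s. cmod (F (Complex s y))) \<le> FB * (1 / (mu * cos d))"
  proof -
    define g where "g = alpha * cos y"
    have g0: "0 < g" using alpha_pos cy cos_d_pos by (simp add: g_def)
    have "((\<lambda>s. FB * (pi * cosh s * exp (- (pi * (- g) * sinh s)))) has_integral
        (FB * ((exp (- (pi * (- g) * sinh (-R))) - exp (- (pi * (- g) * sinh 0))) / (- g)))) {-R..0}"
      using g0 R by (intro has_integral_mult_right has_integral_cosh_exp_sinh) auto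
    moreover have "((\<lambda>s. cmod (F (Complex s y))) has_integral integral {-R..0} (\<lambda>s. cmod (F (Complex s y)))) {-R..0}"
      using integrable_subinterval_real[OF int, of "-R" 0] R by auto
    ultimately have "integral {-R..0} (\<lambda>s. cmod (F (Complex s y)))
        \<le> FB * ((exp (- (pi * (- g) * sinh (-R))) - exp (- (pi * (- g) * sinh 0))) / (- g))"
      using norm_F_strip_le(2)[OF z] by (elim has_integral_le[rotated]) (auto simp: g_def mult_ac)
    also have "\<dots> = FB * ((1 - exp (- (pi * g * sinh R))) / g)"
      by (simp add: minus_divide_right[symmetric] minus_divide_left)
    also have "\<dots> \<le> FB * (1 / g)"
      using FB_pos g0 by (intro mult_left_mono divide_right_mono) auto
    also have "\<dots> \<le> FB * (1 / (mu * cos d))"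
      using FB_pos le[OF mu_le(1)] unfolding g_def by (intro mult_left_mono) auto
    finally show ?thesis .
  qed
  have "integral {-R..R} (\<lambda>s. cmod (F (Complex s y)))
      = integral {-R..0} (\<lambda>s. cmod (F (Complex s y))) + integral {0..R} (\<lambda>s. cmod (F (Complex s y)))"
    using R int by (intro Henstock_Kurzweil_Integration.integral_combine[symmetric]) auto
  also have "\<dots> \<le> FB * (1 / (mu * cos d)) + FB * (1 / (mu * cos d))" by (rule add_mono[OF left right])
  also have "\<dots> = FB * (2 / (mu * cos d))" by (simp flip: add_divide_distrib)
  finally show ?thesis .
qed

text \<open>Serves only to make the vertical sides vanish, so its size does not reach the final
  constant. It combines cosh <= 1 + |sinh| with s exp (- s) <= 1.\<close>

lemma norm_F_bounded:
  assumes z: "z \<in> strip d"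
  shows "cmod (F z) \<le> FB * (pi + 1 / (mu * cos d))"
proof -
  define g where "g = mu * cos d"
  define u where "u = \<bar>sinh (Re z)\<bar>"
  have g0: "0 < g" using mu_pos cos_d_pos by (simp add: g_def)
  have cy: "cos d \<le> cos (Im z)" using z by (intro cos_d_le) (auto simp: strip_def)
  have gb: "g \<le> beta * cos (Im z)" "g \<le> alpha * cos (Im z)"
    unfolding g_def using mu_le mu_pos cy cos_d_pos alpha_pos beta_pos by (auto intro!: mult_mono)
  have "cmod (F z) \<le> FB * (pi * cosh (Re z)) * exp (- (pi * g * u))"
  proof (cases "0 \<le> sinh (Re z)")
    case True
    have "g * sinh (Re z) \<le> beta * cos (Im z) * sinh (Re z)"
      using gb(1) True by (rule mult_right_mono)
    then have "pi * (g * sinh (Re z)) \<le> pi * (beta * cos (Im z) * sinh (Re z))"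
      by (rule mult_left_mono) simp
    then have "exp (- (pi * (beta * cos (Im z)) * sinh (Re z))) \<le> exp (- (pi * g * u))"
      using True by (simp add: u_def mult_ac)
    then show ?thesis using FB_pos
      by (intro order_trans[OF norm_F_strip_le(1)[OF z]] mult_left_mono) auto
  next
    case False
    have "g * u \<le> alpha * cos (Im z) * u"
      using gb(2) by (rule mult_right_mono) (simp add: u_def)
    then have "pi * (g * u) \<le> pi * (alpha * cos (Im z) * u)"
      by (rule mult_left_mono) simp
    moreover have "sinh (Re z) = - u" using False by (simp add: u_def)
    ultimately have "exp (pi * (alpha * cos (Im z)) * sinh (Re z)) \<le> exp (- (pi * g * u))"
      by (simp add: mult_ac)
    then show ?thesis using FB_pos
      by (intro order_trans[OF norm_F_strip_le(2)[OF z]] mult_left_mono) auto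
  qed
  also have "\<dots> = FB * (pi * cosh (Re z) * exp (- (pi * g * u)))" by simp
  also have "\<dots> \<le> FB * (pi + 1 / g)"
  proof (rule mult_left_mono)
    have u0: "0 \<le> u" by (simp add: u_def)
    have "pi * cosh (Re z) * exp (- (pi * g * u)) \<le> pi * (1 + u) * exp (- (pi * g * u))"
      using cosh_le_one_plus_abs_sinh[of "Re z"] by (intro mult_right_mono mult_left_mono) (auto simp: u_def)
    also have "\<dots> = pi * exp (- (pi * g * u)) + (pi * g * u) * exp (- (pi * g * u)) / g"
      using g0 by (simp add: field_simps)
    also have "\<dots> \<le> pi * 1 + 1 / g"
    proof (intro add_mono mult_left_mono divide_right_mono)
      have "pi * g * u \<le> exp (pi * g * u)" using exp_ge_add_one_self[of "pi * g * u"] by linarith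
      then show "(pi * g * u) * exp (- (pi * g * u)) \<le> 1" by (simp add: exp_minus field_simps)
    qed (use g0 u0 in auto)
    finally show "pi * cosh (Re z) * exp (- (pi * g * u)) \<le> pi + 1 / g" by simp
  qed (use FB_pos in simp)
  finally show ?thesis by (simp add: g_def)
qed

text \<open>The leading 3/2 bounds |J| / h, the power of 3/2 comes from \<open>F\<close> on the real
  axis, and 1 + h from the telescoping. It depends neither on \<open>x\<close> nor on the size of
  the full sum, which allows its use with M = N = m0 when limits are exchanged.\<close>

definition tail_bound :: "real \<Rightarrow> int \<Rightarrow> int \<Rightarrow> real" where
  "tail_bound h M N = 3/2 * (K * (3/2) powr (1 - alpha)) * (1 + h) *
     (exp (- (pi * alpha * sinh (real_of_int M * h))) / alpha
        + exp (- (pi * beta * sinh (real_of_int N * h))) / beta)"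

lemma norm_sum_tail_le:
  assumes h: "0 < h" and M: "0 \<le> M" "M \<le> m" and N: "0 \<le> N" "N \<le> m"
  shows "cmod ((\<Sum>k=-m..m. F (of_real (real_of_int k * h)) * of_real (Jfun k h x))
            - (\<Sum>k=-M..N. F (of_real (real_of_int k * h)) * of_real (Jfun k h x))) \<le> tail_bound h M N"
proof -
  define t where "t = (\<lambda>k. F (of_real (real_of_int k * h)) * complex_of_real (Jfun k h x))"
  define A where "A = K * (3/2) powr (1 - alpha)"
  have A0: "0 \<le> A" using K_pos by (simp add: A_def)
  have tb: "cmod (t k) \<le> 3/2 * A * (h * (pi * cosh (real_of_int k * h) * exp (- (pi * beta * sinh (real_of_int k * h)))))"
    and tb': "cmod (t k) \<le> 3/2 * A * (h * (pi * cosh (real_of_int k * h) * exp (pi * alpha * sinh (real_of_int k * h))))" for k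
  proof -
    have J: "\<bar>Jfun k h x\<bar> \<le> 3/2 * h" using h by (intro abs_Jfun_le) simp
    have "cmod (t k) \<le> A * (pi * cosh (real_of_int k * h) * exp (- (pi * beta * sinh (real_of_int k * h)))) * (3/2 * h)"
      unfolding t_def norm_mult norm_of_real
      by (rule mult_mono[OF norm_F_real_le(1)[folded A_def] J]) (use A0 in auto)
    then show "cmod (t k) \<le> 3/2 * A * (h * (pi * cosh (real_of_int k * h) * exp (- (pi * beta * sinh (real_of_int k * h)))))"
      by (simp add: mult_ac)
    have "cmod (t k) \<le> A * (pi * cosh (real_of_int k * h) * exp (pi * alpha * sinh (real_of_int k * h))) * (3/2 * h)"
      unfolding t_def norm_mult norm_of_real
      by (rule mult_mono[OF norm_F_real_le(2)[folded A_def] J]) (use A0 in auto)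
    then show "cmod (t k) \<le> 3/2 * A * (h * (pi * cosh (real_of_int k * h) * exp (pi * alpha * sinh (real_of_int k * h))))"
      by (simp add: mult_ac)
  qed
  have gen: "(\<Sum>k\<in>{a<..m}. 3/2 * A * (h * (pi * cosh (real_of_int k * h) * exp (- (pi * g * sinh (real_of_int k * h))))))
      \<le> 3/2 * A * (1 + h) * (exp (- (pi * g * sinh (real_of_int a * h))) / g)" if "0 < g" "a \<le> m" for g a
  proof -
    have "(\<Sum>k\<in>{a<..m}. 3/2 * A * (h * (pi * cosh (real_of_int k * h) * exp (- (pi * g * sinh (real_of_int k * h))))))
       = 3/2 * A * (\<Sum>k\<in>{a<..m}. h * (pi * cosh (real_of_int k * h) * exp (- (pi * g * sinh (real_of_int k * h)))))"
      by (simp add: sum_distrib_left)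
    also have "\<dots> \<le> 3/2 * A * ((1 + h) / g * (exp (- (pi * g * sinh (real_of_int a * h))) - exp (- (pi * g * sinh (real_of_int m * h)))))"
      using sum_cosh_exp_sinh_le[OF h that] A0 by (intro mult_left_mono) auto
    also have "\<dots> \<le> 3/2 * A * ((1 + h) / g * exp (- (pi * g * sinh (real_of_int a * h))))"
      using A0 h that by (intro mult_left_mono) auto
    finally show ?thesis by simp
  qed
  have split: "{-m..m} = {-M..N} \<union> ({N<..m} \<union> {-m..<-M})" using M N by auto
  have "(\<Sum>k=-m..m. t k) = (\<Sum>k=-M..N. t k) + ((\<Sum>k\<in>{N<..m}. t k) + (\<Sum>k\<in>{-m..<-M}. t k))"
    unfolding split using M N by (subst sum.union_disjoint; (subst sum.union_disjoint)?; auto)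
  then have "(\<Sum>k=-m..m. t k) - (\<Sum>k=-M..N. t k) = (\<Sum>k\<in>{N<..m}. t k) + (\<Sum>k\<in>{-m..<-M}. t k)" by simp
  also have "cmod \<dots> \<le> (\<Sum>k\<in>{N<..m}. cmod (t k)) + (\<Sum>k\<in>{-m..<-M}. cmod (t k))"
    by (intro norm_triangle_le add_mono norm_sum)
  also have "(\<Sum>k\<in>{-m..<-M}. cmod (t k)) = (\<Sum>k\<in>{M<..m}. cmod (t (- k)))"
    by (rule sum.reindex_bij_witness[of _ uminus uminus]) auto
  also have "(\<Sum>k\<in>{N<..m}. cmod (t k)) + (\<Sum>k\<in>{M<..m}. cmod (t (- k)))
      \<le> 3/2 * A * (1 + h) * (exp (- (pi * beta * sinh (real_of_int N * h))) / beta)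
        + 3/2 * A * (1 + h) * (exp (- (pi * alpha * sinh (real_of_int M * h))) / alpha)"
  proof (rule add_mono)
    show "(\<Sum>k\<in>{N<..m}. cmod (t k)) \<le> 3/2 * A * (1 + h) * (exp (- (pi * beta * sinh (real_of_int N * h))) / beta)"
      by (rule order_trans[OF sum_mono[OF tb] gen[OF beta_pos N(2)]])
    have "cmod (t (- k)) \<le> 3/2 * A * (h * (pi * cosh (real_of_int k * h) * exp (- (pi * alpha * sinh (real_of_int k * h)))))" for k
      using tb'[of "- k"] by simp
    then show "(\<Sum>k\<in>{M<..m}. cmod (t (- k))) \<le> 3/2 * A * (1 + h) * (exp (- (pi * alpha * sinh (real_of_int M * h))) / alpha)"
      by (intro order_trans[OF sum_mono gen[OF alpha_pos M(2)]])
  qed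
  finally show ?thesis by (simp add: tail_bound_def t_def A_def distrib_left add.commute)
qed

lemma tail_bound_tendsto_0:
  assumes h: "0 < h"
  shows "(\<lambda>m. tail_bound h (int m) (int m)) \<longlonglongrightarrow> 0"
proof -
  have "filterlim (\<lambda>m. real m * h) at_top sequentially" using h by real_asymp
  then have s: "filterlim (\<lambda>m. sinh (real m * h)) at_top sequentially"
    by (rule filterlim_compose[OF sinh_real_at_top])
  have e: "(\<lambda>m. exp (- (pi * g * sinh (real m * h)))) \<longlonglongrightarrow> 0" if "0 < g" for g
  proof -
    have "filterlim (\<lambda>m. pi * g * sinh (real m * h)) at_top sequentially"
      using that by (intro filterlim_tendsto_pos_mult_at_top[OF tendsto_const _ s]) simp
    then have "filterlim (\<lambda>m. - (pi * g * sinh (real m * h))) at_bot sequentially"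
      by (simp add: filterlim_uminus_at_bot)
    then show ?thesis by (rule filterlim_compose[OF exp_at_bot])
  qed
  have "(\<lambda>m. tail_bound h (int m) (int m)) \<longlonglongrightarrow>
     3/2 * (K * (3/2) powr (1 - alpha)) * (1 + h) * (0 / alpha + 0 / beta)"
    unfolding tail_bound_def of_int_of_nat_eq
    using alpha_pos beta_pos by (intro tendsto_intros e) auto
  then show ?thesis by simp
qed

text \<open>The limits are taken one at a time: first the width \<open>m\<close> of the contour with
  \<open>a j\<close> fixed, then j, then \<open>m0\<close>. The sum at the left end point
  \<open>a j\<close> grows with \<open>m\<close>; it is compared, uniformly in \<open>m\<close>,
  with its window of fixed size \<open>m0\<close>, where \<open>Jfun\<close> tends to 0 term by
  term.\<close>

lemma discretization_truncation_error:
  assumes h: "0 < h" and M: "0 \<le> M" and N: "0 \<le> N" and e: "0 < e" "e < d"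
    and I: "((\<lambda>a. integral {a..x} (\<lambda>t. F (of_real t))) \<longlongrightarrow> I) at_bot"
  shows "cmod (I - (\<Sum>k=-M..N. F (of_real (real_of_int k * h)) * of_real (Jfun k h x)))
     \<le> h / e * (1 + 1 / pi) / sinh (pi * e / h) * (FB * (2 / (mu * cos d))) / pi + tail_bound h M N"
proof -
  define S where "S = (\<lambda>M N x. \<Sum>k=-M..N. F (of_real (real_of_int k * h)) * complex_of_real (Jfun k h x))"
  define W where "W = h / e * (1 + 1 / pi) / sinh (pi * e / h) * (FB * (2 / (mu * cos d))) / pi"
  define B0 where "B0 = FB * (pi + 1 / (mu * cos d))"
  \<comment> \<open>Half-integer multiples of h, the zeros of cos (pi t / h).\<close>
  define a where "a = (\<lambda>j::nat. - ((real j + 1/2) * h))"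
  have tail: "cmod (S (int m) (int m) y - S M' N' y) \<le> tail_bound h M' N'"
    if "0 \<le> M'" "0 \<le> N'" "M' \<le> int m" "N' \<le> int m" for m M' N' y
    unfolding S_def using norm_sum_tail_le[OF h] that by blast
  have abot: "filterlim a at_bot sequentially"
    unfolding a_def using h by real_asymp
  have fin: "cmod (integral {a j..x} (\<lambda>t. F (of_real t)) - S M N x)
      \<le> W + tail_bound h M N + (cmod (S (int m0) (int m0) (a j)) + tail_bound h (int m0) (int m0))"
    if j: "a j \<le> x" for j m0
  proof -
    define c where "c = \<bar>a j\<bar> + \<bar>x\<bar>"
    define v where "v = (\<lambda>m. 2 * e * B0 / ((real m + 1/2) * h - c) / pi * (x - a j))"
    have "v \<longlonglongrightarrow> 0" unfolding v_def using h by real_asymp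
    then have lim: "(\<lambda>m. W + v m + tail_bound h M N + (cmod (S (int m0) (int m0) (a j)) + tail_bound h (int m0) (int m0)))
       \<longlonglongrightarrow> W + 0 + tail_bound h M N + (cmod (S (int m0) (int m0) (a j)) + tail_bound h (int m0) (int m0))"
      by (intro tendsto_intros)
    have "filterlim (\<lambda>m. (real m + 1/2) * h) at_top sequentially" using h by real_asymp
    then have "\<forall>\<^sub>F m in sequentially. c < (real m + 1/2) * h" by (simp add: filterlim_at_top_dense)
    moreover have "\<forall>\<^sub>F m in sequentially. nat M + nat N + m0 \<le> m" by (rule eventually_ge_at_top)
    ultimately have "\<forall>\<^sub>F m in sequentially. cmod (integral {a j..x} (\<lambda>t. F (of_real t)) - S M N x)
        \<le> W + v m + tail_bound h M N + (cmod (S (int m0) (int m0) (a j)) + tail_bound h (int m0) (int m0))"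
    proof eventually_elim
      case (elim m)
      have "cmod (integral {a j..x} (\<lambda>t. F (of_real t))
            - (\<Sum>k=-int m..int m. F (of_real (real_of_int k * h)) * of_real (Jfun k h x - Jfun k h (a j))))
          \<le> h / e * (1 + 1 / pi) / sinh (pi * e / h) * (FB * (2 / (mu * cos d))) / pi
            + 2 * e * B0 / ((real m + 1/2) * h - c) / pi * (x - a j)"
      proof (rule sinc_indefinite_error_finite[OF h e F_holomorphic])
        show "cmod (F z) \<le> B0" if "\<bar>Im z\<bar> \<le> e" for z
          unfolding B0_def using that e by (intro norm_F_bounded) (auto simp: strip_def)
        show "integral {- ((real m + 1/2) * h)..(real m + 1/2) * h} (\<lambda>s. cmod (F (Complex s y)))
           \<le> FB * (2 / (mu * cos d))" if "\<bar>y\<bar> = e" for y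
          using that e h by (intro integral_norm_F_line_le) auto
        have "pi * a j / h = - (pi * real j + pi / 2)" using h by (simp add: a_def field_simps)
        then show "cos (pi * a j / h) = 0" by (simp only: cos_minus cos_add) simp
      qed (use j elim in \<open>auto simp: c_def\<close>)
      also have "(\<Sum>k=-int m..int m. F (of_real (real_of_int k * h)) * of_real (Jfun k h x - Jfun k h (a j)))
          = S (int m) (int m) x - S (int m) (int m) (a j)"
        by (simp add: S_def sum_subtractf right_diff_distrib)
      finally have 1: "cmod (integral {a j..x} (\<lambda>t. F (of_real t)) - (S (int m) (int m) x - S (int m) (int m) (a j))) \<le> W + v m"
        by (simp add: W_def v_def)
      have 2: "cmod (S (int m) (int m) x - S M N x) \<le> tail_bound h M N"
        using elim M N by (intro tail) auto
      have 3: "cmod (S (int m) (int m) (a j) - S (int m0) (int m0) (a j)) \<le> tail_bound h (int m0) (int m0)"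
        using elim by (intro tail) auto
      have tri: "cmod (p - s) \<le> A + B + (cmod r + C)" if "cmod (p - (q - w)) \<le> A" "cmod (q - s) \<le> B" "cmod (w - r) \<le> C"
        for p q r s w :: complex and A B C
      proof -
        have "cmod (p - s) = cmod ((p - (q - w)) + (q - s) - ((w - r) + r))" by simp
        also have "\<dots> \<le> cmod ((p - (q - w)) + (q - s)) + cmod ((w - r) + r)" by (rule norm_triangle_ineq4)
        also have "\<dots> \<le> (cmod (p - (q - w)) + cmod (q - s)) + (cmod (w - r) + cmod r)"
          by (intro add_mono norm_triangle_ineq)
        finally show ?thesis using that by linarith
      qed
      show ?case using tri[OF 1 2 3] by simp
    qed
    from tendsto_lowerbound[OF lim this] show ?thesis by simp
  qed
  have fin2: "cmod (I - S M N x) \<le> W + tail_bound h M N + tail_bound h (int m0) (int m0)" for m0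
  proof -
    have "((\<lambda>y. S (int m0) (int m0) y) \<longlongrightarrow> (\<Sum>k=-int m0..int m0. F (of_real (real_of_int k * h)) * of_real 0)) at_bot"
      unfolding S_def by (intro tendsto_intros Jfun_tendsto_0 h)
    then have "((\<lambda>y. S (int m0) (int m0) y) \<longlongrightarrow> 0) at_bot" by simp
    from tendsto_norm_zero[OF filterlim_compose[OF this abot]]
    have l1: "(\<lambda>j. W + tail_bound h M N + (cmod (S (int m0) (int m0) (a j)) + tail_bound h (int m0) (int m0)))
        \<longlonglongrightarrow> W + tail_bound h M N + (0 + tail_bound h (int m0) (int m0))"
      by (intro tendsto_intros)
    have l2: "(\<lambda>j. cmod (integral {a j..x} (\<lambda>t. F (of_real t)) - S M N x)) \<longlonglongrightarrow> cmod (I - S M N x)"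
      by (intro tendsto_intros filterlim_compose[OF I abot])
    have "\<forall>\<^sub>F j in sequentially. a j \<le> x" using abot by (auto simp: filterlim_at_bot)
    then have "\<forall>\<^sub>F j in sequentially. cmod (integral {a j..x} (\<lambda>t. F (of_real t)) - S M N x)
       \<le> W + tail_bound h M N + (cmod (S (int m0) (int m0) (a j)) + tail_bound h (int m0) (int m0))"
      by eventually_elim (rule fin)
    from tendsto_le[OF _ l1 l2 this] show ?thesis by simp
  qed
  have "(\<lambda>m0. W + tail_bound h M N + tail_bound h (int m0) (int m0)) \<longlonglongrightarrow> W + tail_bound h M N + 0"
    by (intro tendsto_intros tail_bound_tendsto_0 h)
  from tendsto_lowerbound[OF this] fin2 show ?thesis by (simp add: W_def S_def)
qed

section \<open>Returning from \<open>F\<close> to \<open>f\<close>\<close>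

lemma f_of_real_continuous_on: "continuous_on {0<..} (\<lambda>t. f (of_real t))"
proof (rule continuous_on_compose2[OF holomorphic_on_imp_continuous_on[OF analytic_imp_holomorphic[OF f_analytic]]])
  show "of_real ` {0<..} \<subseteq> psi_c ` strip d"
  proof clarify
    fix t :: real assume "0 < t"
    then have "complex_of_real t = psi_c (of_real (psi_inv t))" by (simp add: psi_c_of_real psi_psi_inv)
    then show "complex_of_real t \<in> psi_c ` strip d" using real_in_strip by blast
  qed
qed (intro continuous_intros)

text \<open>Near 0 only a bound of order t^(alpha - 1) is available; it is integrable because alpha
  > 0.\<close>

lemma f_of_real_integrable:
  assumes "0 < tau"
  shows "(\<lambda>t. f (of_real t)) integrable_on {0..tau}"
proof -
  have "(\<lambda>t. f (of_real t)) integrable_on {0<..tau}"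
  proof (rule measurable_bounded_by_integrable_imp_integrable)
    show "(\<lambda>t. f (of_real t)) \<in> borel_measurable (lebesgue_on {0<..tau})"
      by (intro continuous_imp_measurable_on_sets_lebesgue continuous_on_subset[OF f_of_real_continuous_on]) auto
    have "(\<lambda>t. K * (1 + tau) powr (1 - alpha) * t powr (alpha - 1)) integrable_on {0..tau}"
      using assms alpha_pos by (intro integrable_on_mult_right integrable_on_powr_from_0) auto
    then show "(\<lambda>t. K * (1 + tau) powr (1 - alpha) * t powr (alpha - 1)) integrable_on {0<..tau}"
      by (rule integrable_spike_set) (auto intro: negligible_subset[of "{0}"])
    fix t assume t: "t \<in> {0<..tau}"
    then have "complex_of_real t = psi_c (of_real (psi_inv t))" by (simp add: psi_c_of_real psi_psi_inv)
    then have im: "complex_of_real t \<in> psi_c ` strip d" using real_in_strip by blast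
    have "complex_of_real t \<noteq> -1" using t by (auto simp: complex_eq_iff)
    from f_bound[OF im this]
    have "cmod (f (of_real t)) \<le> K * (cmod ((of_real t / (1 + of_real t)) powr (of_real (alpha - 1)))
        * exp (- beta * t))"
      by (simp add: norm_mult)
    also have "cmod ((of_real t / (1 + of_real t)) powr (of_real (alpha - 1))) = (t / (1 + t)) powr (alpha - 1)"
    proof -
      have "complex_of_real t / (1 + of_real t) = of_real (t / (1 + t))" by simp
      then show ?thesis using t by (subst norm_powr_real_powr') (auto simp: norm_divide simp del: of_real_divide)
    qed
    also have "K * ((t / (1 + t)) powr (alpha - 1) * exp (- beta * t))
        \<le> K * (((1 + tau) powr (1 - alpha) * t powr (alpha - 1)) * 1)"
    proof (intro mult_left_mono mult_mono)
      have "(t / (1 + t)) powr (alpha - 1) = t powr (alpha - 1) * (1 + t) powr (1 - alpha)"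
      proof -
        have "(1 + t) powr (1 - alpha) = inverse ((1 + t) powr (alpha - 1))"
          by (simp flip: powr_minus)
        then show ?thesis using t by (simp add: powr_divide) (simp add: divide_inverse)
      qed
      also have "\<dots> \<le> t powr (alpha - 1) * (1 + tau) powr (1 - alpha)"
        using t alpha_le by (intro mult_left_mono powr_mono2) auto
      finally show "(t / (1 + t)) powr (alpha - 1) \<le> (1 + tau) powr (1 - alpha) * t powr (alpha - 1)"
        by (simp add: mult.commute)
    qed (use t K_pos beta_pos in auto)
    finally show "cmod (f (of_real t)) \<le> K * (1 + tau) powr (1 - alpha) * t powr (alpha - 1)"
      by simp
  qed simp
  then show ?thesis
    by (rule integrable_spike_set) (auto intro: negligible_subset[of "{0}"])
qed

text \<open>Substitution on {a..x} stays away from the singularity of f at 0. The limit then follows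
  from continuity of the integral in its lower end point, as \<open>psi a\<close> decreases to
  0.\<close>

lemma integral_F_tendsto:
  assumes tau: "0 < tau"
  shows "((\<lambda>a. integral {a..psi_inv tau} (\<lambda>t. F (of_real t))) \<longlongrightarrow> integral {0..tau} (\<lambda>t. f (of_real t))) at_bot"
proof -
  define x where "x = psi_inv tau"
  have px: "psi x = tau" by (simp add: x_def psi_psi_inv tau)
  have eq: "integral {a..x} (\<lambda>t. F (of_real t)) = integral {psi a..tau} (\<lambda>t. f (of_real t))" if "a \<le> x" for a
  proof -
    have "((\<lambda>t. (pi * cosh t * (exp (pi * sinh t) / (1 + exp (pi * sinh t)))) *\<^sub>R f (of_real (psi t)))
        has_integral (integral {psi a..psi x} (\<lambda>t. f (of_real t)))) {a..x}"
    proof (rule has_integral_substitution[OF that psi_mono[OF that]])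
      show "psi ` {a..x} \<subseteq> {psi a..psi x}" by (auto intro: psi_mono)
      show "continuous_on {psi a..psi x} (\<lambda>t. f (of_real t))"
        by (rule continuous_on_subset[OF f_of_real_continuous_on]) (use psi_pos[of a] in auto)
    qed (rule has_field_derivative_at_within[OF psi_has_derivative])
    moreover have "(pi * cosh t * (exp (pi * sinh t) / (1 + exp (pi * sinh t)))) *\<^sub>R f (of_real (psi t)) = F (of_real t)" for t
      using DERIV_imp_deriv[OF psi_has_derivative, of t] by (simp add: F_of_real scaleR_conv_of_real mult.commute)
    ultimately show ?thesis by (simp add: integral_unique px)
  qed
  have "continuous_on {0..tau} (\<lambda>u. integral {u..tau} (\<lambda>t. f (of_real t)))"
    by (rule indefinite_integral_continuous_1'[OF f_of_real_integrable[OF tau]])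
  then have "((\<lambda>u. integral {u..tau} (\<lambda>t. f (of_real t))) \<longlongrightarrow> integral {0..tau} (\<lambda>t. f (of_real t))) (at 0 within {0..tau})"
    using tau by (auto simp: continuous_on_def)
  moreover have "filterlim psi (at 0 within {0..tau}) at_bot"
    unfolding filterlim_at
  proof
    show "\<forall>\<^sub>F a in at_bot. psi a \<in> {0..tau} \<and> psi a \<noteq> 0"
      using eventually_le_at_bot[of x]
    proof eventually_elim
      case (elim a)
      then show ?case using psi_mono[OF elim] psi_pos[of a] px by auto
    qed
    show "(psi \<longlongrightarrow> 0) at_bot" by (rule psi_tendsto_0)
  qed
  ultimately have "((\<lambda>a. integral {psi a..tau} (\<lambda>t. f (of_real t))) \<longlongrightarrow> integral {0..tau} (\<lambda>t. f (of_real t))) at_bot"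
    by (rule filterlim_compose)
  moreover have "\<forall>\<^sub>F a in at_bot. integral {psi a..tau} (\<lambda>t. f (of_real t)) = integral {a..x} (\<lambda>t. F (of_real t))"
    using eventually_le_at_bot[of x] by eventually_elim (simp add: eq)
  ultimately show ?thesis unfolding x_def by (rule Lim_transform_eventually)
qed

section \<open>The final constants\<close>

text \<open>With E = exp (- pi d / h), 1 / sinh (pi d / h) is 2 E / (1 - E^2), and the assumption on
  h gives E^2 <= exp (- pi mu e). The 2 is cancelled by (1 + 1/pi) / pi <= 1/2.\<close>

lemma discretization_bound_le:
  assumes h: "0 < h" and q: "mu * exp 1 \<le> 2 * d / h"
  shows "h / d * (1 + 1 / pi) / sinh (pi * d / h) * (FB * (2 / (mu * cos d))) / pi
     \<le> 2 * K / (mu * d) * (ct powr (1 - alpha) / ((1 - exp (- pi * mu * exp 1)) * cd powr (alpha + beta) * cos d))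
          * exp (- (pi * d / h)) * h"
proof -
  define E where "E = exp (- (pi * d / h))"
  define D where "D = 1 - exp (- pi * mu * exp 1)"
  have D0: "0 < D" using mu_pos by (simp add: D_def)
  have "pi * (mu * exp 1) \<le> pi * (2 * d / h)" using q by (rule mult_left_mono) simp
  then have "exp (- (pi * (2 * d / h))) \<le> exp (- pi * mu * exp 1)" by (simp add: mult_ac)
  moreover have "exp (- (pi * (2 * d / h))) = E * E" by (simp add: E_def field_simps flip: exp_add)
  ultimately have EE: "D \<le> 1 - E * E" unfolding D_def by linarith
  have E0: "0 < E" by (simp add: E_def)
  have sh: "sinh (pi * d / h) = (1 - E * E) / (2 * E)"
  proof -
    have "exp (pi * d / h) = 1 / E" by (simp add: E_def exp_minus field_simps)
    moreover have "exp (- (pi * d / h)) = E" by (simp add: E_def)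
    ultimately have "sinh (pi * d / h) = (1 / E - E) / 2" unfolding sinh_field_def by simp
    also have "\<dots> = (1 - E * E) / (2 * E)" using E0 by (simp add: field_simps)
    finally show ?thesis .
  qed
  have s1: "1 / sinh (pi * d / h) \<le> 2 * E / D"
    unfolding sh using EE D0 E0 by (simp add: frac_le)
  have p: "(1 + 1 / pi) / pi \<le> 1/2"
  proof -
    have "2 / pi \<le> 1" using pi_gt3 by simp
    then have "2 + 2 / pi \<le> pi" using pi_gt3 by linarith
    then show ?thesis by simp
  qed
  define G where "G = h / d * (FB * (2 / (mu * cos d)))"
  have G0: "0 \<le> G" using h d_pos FB_pos mu_pos cos_d_pos by (simp add: G_def)
  have "h / d * (1 + 1 / pi) / sinh (pi * d / h) * (FB * (2 / (mu * cos d))) / pi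
      = G * (((1 + 1 / pi) / pi) * (1 / sinh (pi * d / h)))"
    unfolding G_def divide_inverse by (simp only: mult_ac mult_1_left)
  also have "\<dots> \<le> G * ((1/2) * (2 * E / D))"
    using p s1 G0 E0 D0 sinh_real_pos_iff[of "pi * d / h"] d_pos h by (intro mult_left_mono mult_mono) auto
  also have "\<dots> = 2 * K / (mu * d) * (ct powr (1 - alpha) / (D * cd powr (alpha + beta) * cos d)) * E * h"
    using D0 cos_d_pos cd_pos mu_pos d_pos by (simp add: G_def FB_def field_simps)
  finally show ?thesis by (simp add: E_def D_def)
qed

text \<open>Both tails are first brought to the common bound E / mu. Then L / X = h / d turns 2 K /
  mu * L / X into 2 K h / (mu d) and exp (- pi X / L) into exp (- pi d / h).\<close>

lemma tail_bound_le:
  fixes L X nu h :: real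
  assumes L: "1 \<le> L" and X: "X = mu * exp L / 2" and nu: "nu = max alpha beta" "nu * exp 1 / 2 \<le> X"
    and h: "0 < h" "h \<le> L" and dh: "L / X = h / d"
    and M: "ln (2 * X / alpha) \<le> real_of_int M * h" and N: "ln (2 * X / beta) \<le> real_of_int N * h"
  shows "tail_bound h M N \<le> 2 * K / (mu * d) * exp (pi * (1 + 5 * alpha + 6 * beta) / 12) * exp (- (pi * d / h)) * h"
proof -
  define E where "E = exp (- (pi * X) + pi * nu\<^sup>2 / (4 * X))"
  define A where "A = (3/2) powr (1 - alpha)"
  have X0: "0 < X" using mu_pos by (simp add: X)
  have "tail_bound h M N \<le> 3/2 * (K * A) * (1 + h) * (E / mu + E / mu)"
    unfolding tail_bound_def A_def[symmetric]
  proof (rule mult_left_mono[OF add_mono])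
    have "exp (- (pi * alpha * sinh (real_of_int M * h))) \<le> E"
      unfolding E_def using alpha_pos X0 M by (intro exp_minus_sinh_le) (auto simp: nu)
    then show "exp (- (pi * alpha * sinh (real_of_int M * h))) / alpha \<le> E / mu"
      using mu_pos mu_le by (intro frac_le) (auto simp: E_def)
    have "exp (- (pi * beta * sinh (real_of_int N * h))) \<le> E"
      unfolding E_def using beta_pos X0 N by (intro exp_minus_sinh_le) (auto simp: nu)
    then show "exp (- (pi * beta * sinh (real_of_int N * h))) / beta \<le> E / mu"
      using mu_pos mu_le by (intro frac_le) (auto simp: E_def)
    show "0 \<le> 3/2 * (K * A) * (1 + h)" using K_pos h by (simp add: A_def)
  qed
  also have "\<dots> = (2 * K / mu * (L / X)) * (3/2 * A * (1 + h) * (X / L) * E)"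
    using X0 L mu_pos by (simp add: field_simps)
  also have "\<dots> \<le> (2 * K / mu * (L / X)) * (exp (- (pi * X / L)) * exp (pi * (1 + 5 * alpha + 6 * beta) / 12))"
    unfolding E_def A_def
    by (intro mult_left_mono tail_constant_le[OF L mu_pos mu_le alpha_le _ _ X nu(2) h])
      (use K_pos mu_pos X0 L alpha_pos beta_pos in \<open>auto simp: nu(1)\<close>)
  also have "X / L = d / h" using dh X0 L h d_pos by (simp add: field_simps)
  then have "pi * X / L = pi * d / h" by (simp flip: times_divide_eq_right)
  finally show ?thesis unfolding dh by (simp add: mult_ac)
qed

end

text \<open>The shift is rounded down, so the number of terms is rounded up and the cut is never
  short of its target.\<close>

lemma floor_shift_ge:
  fixes h r :: real
  assumes "0 < h"
  shows "real n * h - r \<le> real_of_int (int n - \<lfloor>r / h\<rfloor>) * h"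
proof -
  have "real_of_int \<lfloor>r / h\<rfloor> * h \<le> (r / h) * h" using assms by (intro mult_right_mono) auto
  then show ?thesis using assms by (simp add: left_diff_distrib)
qed

theorem theorem14:
  fixes d K alpha beta :: real and n :: nat
    and psi_c :: "complex \<Rightarrow> complex" and f :: "complex \<Rightarrow> complex"
  assumes d_pos: "0 < d" and d_lt: "d < pi / 2"
    and psi_c_holo: "psi_c holomorphic_on strip d"
    and psi_c_exp: "\<forall>z\<in>strip d. exp (psi_c z) = 1 + exp (of_real pi * sinh z)"
    and psi_c_0: "psi_c 0 = of_real (ln 2)"
    and f_analytic: "f analytic_on (psi_c ` strip d)"
    and K_pos: "0 < K" and beta_pos: "0 < beta" and alpha_pos: "0 < alpha" and alpha_le: "alpha \<le> 1"
    and f_bound: "\<forall>z\<in>psi_c ` strip d. z \<noteq> -1 \<longrightarrow>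
        cmod (f z) \<le> K * cmod ((z / (1 + z)) powr (of_real (alpha - 1)) * exp (- of_real beta * z))"
    and n_pos: "0 < n"
    and n_ge: "real n \<ge> max alpha beta * exp 1 / (2 * d)"
    and MN: "let mu = min alpha beta; h = ln (2 * d * real n / mu) / real n;
               M = (if mu = alpha then int n else int n - \<lfloor>ln (alpha / beta) / h\<rfloor>);
               N = (if mu = alpha then int n - \<lfloor>ln (beta / alpha) / h\<rfloor> else int n)
             in real_of_int M * h \<ge> x_gamma alpha \<and> real_of_int N * h \<ge> x_gamma beta"
  shows "let mu = min alpha beta; h = ln (2 * d * real n / mu) / real n;
             M = (if mu = alpha then int n else int n - \<lfloor>ln (alpha / beta) / h\<rfloor>);
             N = (if mu = alpha then int n - \<lfloor>ln (beta / alpha) / h\<rfloor> else int n);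
             c = 1 + 1 / cos (pi / 2 * sin d);
             ct = (1 + ln (1 + c)) / ln (1 + c) * c;
             C = 2 * K / (mu * d) *
                 (ct powr (1 - alpha) /
                    ((1 - exp (- pi * mu * exp 1)) * (cos (pi / 2 * sin d)) powr (alpha + beta) * cos d)
                  + exp (pi * (1 + 5 * alpha + 6 * beta) / 12))
         in \<forall>tau > 0.
              cmod (integral {0..tau} (\<lambda>t. f (of_real t))
                    - (\<Sum>k = -M..N. f (of_real (psi (real_of_int k * h)))
                          * of_real (deriv psi (real_of_int k * h))
                          * of_real (Jfun k h (psi_inv tau))))
              \<le> C * exp (- pi * d * real n / ln (2 * d * real n / mu)) * ln (2 * d * real n / mu) / real n"
proof -
  interpret double_exponential d K alpha beta psi_c f
    using assms by unfold_locales auto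
  define nu where "nu = max alpha beta"
  define X where "X = d * real n"
  define L where "L = ln (2 * d * real n / mu)"
  define h where "h = L / real n"
  define M where "M = (if mu = alpha then int n else int n - \<lfloor>ln (alpha / beta) / h\<rfloor>)"
  define N where "N = (if mu = alpha then int n - \<lfloor>ln (beta / alpha) / h\<rfloor> else int n)"
  have n1: "1 \<le> real n" using n_pos by simp
  have X0: "0 < X" using d_pos n_pos by (simp add: X_def)
  have nuX: "nu * exp 1 / 2 \<le> X"
    using n_ge d_pos by (simp add: nu_def X_def field_simps)
  have mu_nu: "mu \<le> nu" "alpha \<le> nu" "beta \<le> nu" by (auto simp: mu_def nu_def)
  have large: "exp 1 \<le> 2 * X / g" if "0 < g" "g \<le> nu" for g
  proof -
    have "g * exp 1 \<le> nu * exp 1" using that by (intro mult_right_mono) auto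
    then have "g * exp 1 \<le> 2 * X" using nuX by linarith
    then show ?thesis using that by (simp add: field_simps)
  qed
  have ln1: "1 \<le> ln (2 * X / g)" if "0 < g" "g \<le> nu" for g
    using large[OF that] that X0 by (subst ln_ge_iff) auto
  have LX: "L = ln (2 * X / mu)" by (simp add: L_def X_def mult.assoc)
  have L1: "1 \<le> L" unfolding LX using mu_pos mu_nu by (intro ln1) auto
  have eL: "exp L = 2 * X / mu" unfolding LX using X0 mu_pos by simp
  have h0: "0 < h" using L1 n1 by (simp add: h_def)
  have hL: "h \<le> L" using L1 n1 by (simp add: h_def field_simps)
  have nh: "real n * h = L" using n1 by (simp add: h_def)
  \<comment> \<open>On the side of the smaller parameter the index is n and n h = L = ln (2 X / mu).
    On the other side the shift by log (nu / mu) / h lowers L to ln (2 X / nu), up to rounding in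
    the favourable direction.\<close>
  have MN: "ln (2 * X / alpha) \<le> real_of_int M * h \<and> ln (2 * X / beta) \<le> real_of_int N * h"
  proof (cases "mu = alpha")
    case True
    have "ln (2 * X / beta) = L - ln (beta / alpha)"
      unfolding LX True using X0 alpha_pos beta_pos by (simp add: ln_div ln_mult)
    also have "\<dots> \<le> real_of_int N * h"
      using floor_shift_ge[OF h0, of n "ln (beta / alpha)"] True by (simp add: N_def nh)
    finally show ?thesis using True LX by (simp add: M_def nh)
  next
    case False
    then have b: "mu = beta" by (auto simp: mu_def min_def split: if_splits)
    have "ln (2 * X / alpha) = L - ln (alpha / beta)"
      unfolding LX b using X0 alpha_pos beta_pos by (simp add: ln_div ln_mult)
    also have "\<dots> \<le> real_of_int M * h"
      using floor_shift_ge[OF h0, of n "ln (alpha / beta)"] False by (simp add: M_def nh)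
    finally show ?thesis using False LX b by (simp add: N_def nh)
  qed
  have "0 < real_of_int M * h" "0 < real_of_int N * h"
    using MN ln1[OF alpha_pos mu_nu(2)] ln1[OF beta_pos mu_nu(3)] by linarith+
  then have M0: "0 \<le> M" and N0: "0 \<le> N" using h0 by (auto simp: zero_less_mult_iff)
  have dh: "L / X = h / d" by (simp add: h_def X_def)
  have XL: "X = mu * exp L / 2" unfolding eL using mu_pos by simp
  have tail: "tail_bound h M N \<le> 2 * K / (mu * d) * exp (pi * (1 + 5 * alpha + 6 * beta) / 12) * exp (- (pi * d / h)) * h"
    using MN by (intro tail_bound_le[OF L1 XL nu_def nuX h0 hL dh]) auto
  \<comment> \<open>From e L <= exp L = 2 X / mu and 2 X / L = 2 d / h.\<close>
  have q: "mu * exp 1 \<le> 2 * d / h"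
  proof -
    have "L \<le> exp (L - 1)" using exp_ge_add_one_self[of "L - 1"] by simp
    then have "exp 1 * L \<le> exp 1 * exp (L - 1)" by (intro mult_left_mono) auto
    also have "\<dots> = exp L" by (simp flip: exp_add)
    finally have "mu * (exp 1 * L) \<le> 2 * X" using mu_pos unfolding eL by (simp add: field_simps)
    moreover have "2 * d / h = 2 * X / L" using dh X0 L1 d_pos h0 by (simp add: field_simps)
    moreover have "mu * exp 1 \<le> 2 * X / L" using calculation(1) L1 by (simp add: pos_le_divide_eq mult_ac)
    ultimately show ?thesis by simp
  qed
  have main: "cmod (integral {0..tau} (\<lambda>t. f (of_real t))
       - (\<Sum>k=-M..N. F (of_real (real_of_int k * h)) * of_real (Jfun k h (psi_inv tau))))
     \<le> 2 * K / (mu * d) * (ct powr (1 - alpha) / ((1 - exp (- pi * mu * exp 1)) * cd powr (alpha + beta) * cos d)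
          + exp (pi * (1 + 5 * alpha + 6 * beta) / 12)) * exp (- (pi * d / h)) * h"
    (is "?err \<le> _") if tau: "0 < tau" for tau
  proof -
    define W where "W = (\<lambda>e. h / e * (1 + 1 / pi) / sinh (pi * e / h) * (FB * (2 / (mu * cos d))) / pi)"
    \<comment> \<open>The error does not depend on \<open>e\<close>, and \<open>W\<close> is
      continuous at \<open>d\<close>.\<close>
    have "((\<lambda>e. W e + tail_bound h M N) \<longlongrightarrow> W d + tail_bound h M N) (at_left d)"
      unfolding W_def using d_pos h0 by (intro tendsto_intros) auto
    moreover have "\<forall>\<^sub>F e in at_left d. ?err \<le> W e + tail_bound h M N"
      using eventually_at_left_real[OF d_pos]
    proof eventually_elim
      case (elim e)
      then show ?case unfolding W_def
        by (intro discretization_truncation_error[OF h0 M0 N0 _ _ integral_F_tendsto[OF tau]]) auto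
    qed
    ultimately have "?err \<le> W d + tail_bound h M N" by (intro tendsto_lowerbound) auto
    also have "W d \<le> 2 * K / (mu * d) * (ct powr (1 - alpha) / ((1 - exp (- pi * mu * exp 1)) * cd powr (alpha + beta) * cos d))
          * exp (- (pi * d / h)) * h"
      unfolding W_def by (rule discretization_bound_le[OF h0 q])
    finally have "?err \<le> 2 * K / (mu * d) * (ct powr (1 - alpha) / ((1 - exp (- pi * mu * exp 1)) * cd powr (alpha + beta) * cos d))
          * exp (- (pi * d / h)) * h
        + 2 * K / (mu * d) * exp (pi * (1 + 5 * alpha + 6 * beta) / 12) * exp (- (pi * d / h)) * h"
      using tail by linarith
    then show ?thesis by (simp only: distrib_left distrib_right)
  qed
  have expo: "- pi * d * real n / L = - (pi * d / h)" using n1 by (simp add: h_def)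
  show ?thesis
    unfolding Let_def mu_def[symmetric] L_def[symmetric] h_def[symmetric] M_def[symmetric] N_def[symmetric]
      cd_def[symmetric] cc_def[symmetric] ct_def[symmetric] F_of_real[symmetric] expo times_divide_eq_right[symmetric, of _ L]
    using main by blast
qed

end
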